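(* Let $P(z)=\sum_{n\ge0}P_nz^n$ be the unique formal power series satisfying $$P=1+zP^2+z^4P^4+z^7P^6+\cdots=1+\frac{zP^2}{1-z^3P^2}.$$ Then the quiddity generating function $Q(z)=\sum_{n\ge 0}Q_nz^n$ satisfies $$Q(z)=1+zP^2+z^4P^5+z^7P^8+\cdots=1+\frac{zP^2}{1-z^3P^3}.$$
   Context: For $n\ge1$, fix a convex $(n+2)$-gon with vertices labelled $0,1,\dots,n+1$ in cyclic order. A dissection is a set of pairwise non-crossing diagonals (chords) of it; these partition the polygon into sub-polygons (cells). The quiddity of a dissection is the tuple $(a_0,\dots,a_{n+1})$, where $a_i$ is the number of cells having vertex $i$. A dissection is 3-periodic if every cell has a number of vertices divisible by $3$. $Q_n$ is the number of distinct tuples that occur as quiddities of 3-periodic dissections of the $(n+2)$-gon, with the convention $Q_0=1$. *)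

theory Defs
  imports "HOL-Computational_Algebra.Formal_Power_Series"
begin

text \<open>
  The points of a convex polygon are natural numbers in their cyclic order, so every finite vertex
  set \<open>V\<close> with at least three elements spans a convex polygon. A chord between two vertices is the
  pair \<open>(i, j)\<close> with \<open>i < j\<close>; it is a side of the polygon if \<open>i\<close> and \<open>j\<close> are cyclically
  consecutive in \<open>V\<close>, i.e. if \<open>V\<close> has no vertex between them, or none outside \<open>{i..j}\<close>.
\<close>

definition chords :: "nat set \<Rightarrow> (nat \<times> nat) set" where
  "chords V = {(i, j). i \<in> V \<and> j \<in> V \<and> i < j}"

definition sides :: "nat set \<Rightarrow> (nat \<times> nat) set" where
  "sides V = {(i, j) \<in> chords V. V \<inter> {i<..<j} = {} \<or> V \<subseteq> {i..j}}"

definition diagonals :: "nat set \<Rightarrow> (nat \<times> nat) set" where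
  "diagonals V = chords V - sides V"

definition crossing :: "nat \<times> nat \<Rightarrow> nat \<times> nat \<Rightarrow> bool" where
  "crossing d e \<longleftrightarrow>
     fst d < fst e \<and> fst e < snd d \<and> snd d < snd e \<or>
     fst e < fst d \<and> fst d < snd e \<and> snd e < snd d"

definition dissection :: "nat set \<Rightarrow> (nat \<times> nat) set \<Rightarrow> bool" where
  "dissection V D \<longleftrightarrow> D \<subseteq> diagonals V \<and> (\<forall>d\<in>D. \<forall>e\<in>D. \<not> crossing d e)"

text \<open>
  A cell is given by its vertex set: it is a sub-polygon bounded by sides of the polygon and
  diagonals of the dissection, and not cut by any diagonal of the dissection. Since \<open>D\<close> does not
  cross the boundary of such a sub-polygon, a diagonal cutting it has to join two of its vertices.
\<close>

definition cells :: "nat set \<Rightarrow> (nat \<times> nat) set \<Rightarrow> nat set set" where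
  "cells V D = {C. C \<subseteq> V \<and> card C \<ge> 3 \<and> sides C \<subseteq> sides V \<union> D \<and> diagonals C \<inter> D = {}}"

definition three_periodic :: "nat set \<Rightarrow> (nat \<times> nat) set \<Rightarrow> bool" where
  "three_periodic V D \<longleftrightarrow> dissection V D \<and> (\<forall>C\<in>cells V D. 3 dvd card C)"

definition quiddity :: "nat \<Rightarrow> (nat \<times> nat) set \<Rightarrow> nat list" where
  "quiddity n D = map (\<lambda>i. card {C \<in> cells {0..n+1} D. i \<in> C}) [0..<n+2]"

definition Q :: "nat \<Rightarrow> nat" where
  "Q n = (if n = 0 then 1 else card {quiddity n D |D. three_periodic {0..n+1} D})"

definition Q_fps :: "rat fps" where
  "Q_fps = Abs_fps (\<lambda>n. of_nat (Q n))"

end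

theory Submission
  imports Defs
begin

text \<open>
  Cutting off ears shows that the quiddities of 3-periodic dissections are the words obtained from
  a block of \<open>3k+3\<close> ones by inserting blocks of \<open>3k+1\<close> ones between neighbours, each of which is
  increased by one. Different dissections may give the same word: if two sides of a cell are
  diagonals \<open>ab\<close> and \<open>cd\<close>, and the two chains of vertices \<open>a..c\<close> and \<open>d..b\<close> of the cell
  between them have lengths divisible by 3, then replacing \<open>ab\<close>, \<open>cd\<close> by \<open>ac\<close>, \<open>db\<close> preserves
  both 3-periodicity and quiddity. Numbering the sides of each cell from its base (the side facing
  the root side of the polygon), such surgeries lead to a canonical dissection, in which every cell
  other than the root cell has only trivial polygons on its sides \<open>3, 6, 9, \<dots>\<close>. A canonical
  dissection is determined by its quiddity, so \<open>Q\<close> counts canonical dissections. In a cell with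
  \<open>3k+3\<close> sides, only \<open>2k+2\<close> of the \<open>3k+2\<close> sides besides the base may carry something, whereas
  the root cell is unrestricted; this is the difference between the exponents \<open>2k+2\<close> and \<open>3k+2\<close>
  of \<open>P\<close>.
\<close>

section \<open>Removing an ear from a dissection\<close>

lemma finite_cells: "finite V \<Longrightarrow> finite (cells V D)"
  by (rule finite_subset[of _ "Pow V"]) (auto simp: cells_def)

lemma diagonals_iff:
  "(p, q) \<in> diagonals V \<longleftrightarrow>
     p \<in> V \<and> q \<in> V \<and> p < q \<and> (\<exists>x\<in>V. p < x \<and> x < q) \<and> (\<exists>x\<in>V. x < p \<or> q < x)"
  unfolding diagonals_def sides_def chords_def by (auto simp: subset_iff not_le)

lemma sides_iff:
  "(p, q) \<in> sides V \<longleftrightarrow>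
     p \<in> V \<and> q \<in> V \<and> p < q \<and> ((\<forall>x\<in>V. \<not> (p < x \<and> x < q)) \<or> (\<forall>x\<in>V. p \<le> x \<and> x \<le> q))"
  unfolding sides_def chords_def by auto

lemma dissection_empty: "dissection V {}"
  by (simp add: dissection_def)

text \<open>All sides of a cell are now sides of \<open>V\<close>. The one from \<open>Min C\<close>
  to \<open>Max C\<close> makes \<open>C\<close> reach both ends of \<open>V\<close>; a vertex
  missed by \<open>C\<close> would lie under a side of \<open>C\<close>, which must then be that
  long side, leaving \<open>C\<close> only two vertices.\<close>

lemma cells_empty:
  assumes "finite V" "card V \<ge> 3"
  shows "cells V {} = {V}"
proof -
  have "C = V" if C: "C \<in> cells V {}" for C
  proof (rule ccontr)
    assume "C \<noteq> V"
    from C have CV: "C \<subseteq> V" and c3: "card C \<ge> 3" and sd: "sides C \<subseteq> sides V"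
      by (auto simp: cells_def)
    have finC: "finite C" using CV assms(1) finite_subset by blast
    obtain y where y: "y \<in> V" "y \<notin> C" using CV \<open>C \<noteq> V\<close> by blast
    have ne: "C \<noteq> {}" using c3 by auto
    define m M where "m = Min C" and "M = Max C"
    have mM: "m \<in> C" "M \<in> C" "\<And>x. x \<in> C \<Longrightarrow> m \<le> x" "\<And>x. x \<in> C \<Longrightarrow> x \<le> M"
      using finC ne by (auto simp: m_def M_def)
    have "\<not> C \<subseteq> {m, M}"
    proof
      assume "C \<subseteq> {m, M}"
      hence "card C \<le> card {m, M}" by (intro card_mono) auto
      also have "\<dots> \<le> 2" by (simp add: card_insert_if)
      finally show False using c3 by simp
    qed
    then obtain z where z: "z \<in> C" "z \<noteq> m" "z \<noteq> M" by blast
    have zz: "m < z" "z < M" using z mM(3)[OF z(1)] mM(4)[OF z(1)] by auto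
    have "(m, M) \<in> sides C" unfolding sides_iff using mM zz by auto
    hence "(m, M) \<in> sides V" using sd by blast
    hence "\<forall>x\<in>V. m \<le> x \<and> x \<le> M" unfolding sides_iff using z zz CV by blast
    hence ymM: "m < y" "y < M" using y mM by (force simp: order.strict_iff_order)+
    define p q where "p = Max {x\<in>C. x < y}" and "q = Min {x\<in>C. y < x}"
    have p: "p \<in> {x\<in>C. x < y}" unfolding p_def by (rule Max_in) (use finC mM ymM in auto)
    have q: "q \<in> {x\<in>C. y < x}" unfolding q_def by (rule Min_in) (use finC mM ymM in auto)
    have nb: "\<not> (p < x \<and> x < q)" if "x \<in> C" for x
    proof
      assume h: "p < x \<and> x < q"
      have "x \<noteq> y" using that y by blast
      then consider "x < y" | "y < x" by linarith
      thus False
      proof cases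
        case 1
        hence "x \<le> p" unfolding p_def using that finC by (intro Max_ge) auto
        thus False using h by simp
      next
        case 2
        hence "q \<le> x" unfolding q_def using that finC by (intro Min_le) auto
        thus False using h by simp
      qed
    qed
    have "(p, q) \<in> sides C" unfolding sides_iff using p q nb by auto
    hence "(p, q) \<in> sides V" using sd by blast
    hence "\<forall>x\<in>V. p \<le> x \<and> x \<le> q" unfolding sides_iff using y p q by auto
    hence "p \<le> m" "M \<le> q" using mM CV by auto
    hence "p = m" "q = M" using p q mM by (auto intro: antisym)
    thus False using nb[OF z(1)] zz by simp
  qed
  moreover have "V \<in> cells V {}" using assms by (auto simp: cells_def)
  ultimately show ?thesis by blast
qed

lemma dissection_insert_ear:
  assumes V: "finite V" and ij: "(i, j) \<in> diagonals V"
    and D: "dissection (V - {i<..<j}) D"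
  shows "dissection V (insert (i, j) D)"
proof -
  have sub: "diagonals (V - {i<..<j}) \<subseteq> diagonals V"
    by (auto simp: diagonals_iff)
  have DD: "D \<subseteq> diagonals (V - {i<..<j})" using D by (simp add: dissection_def)
  have nc: "\<not> crossing (i, j) d \<and> \<not> crossing d (i, j)" if "d \<in> D" for d
    using that DD by (cases d) (auto simp: diagonals_iff crossing_def)
  have "\<not> crossing (i, j) (i, j)" by (simp add: crossing_def)
  with nc D DD sub ij show ?thesis unfolding dissection_def by blast
qed

text \<open>Since \<open>(i, j)\<close> has least span and nothing crosses it, no other diagonal
  ends strictly between \<open>i\<close> and \<open>j\<close>.\<close>

lemma dissection_remove_ear:
  assumes V: "finite V" and D: "dissection V D" and ij: "(i, j) \<in> D"
    and min: "\<And>p q. (p, q) \<in> D \<Longrightarrow> j - i \<le> q - p"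
  shows "dissection (V - {i<..<j}) (D - {(i, j)})"
proof -
  have DD: "D \<subseteq> diagonals V" using D by (simp add: dissection_def)
  have ijV: "i \<in> V" "j \<in> V" "i < j" using ij DD by (auto simp: diagonals_iff)
  have "(p, q) \<in> diagonals (V - {i<..<j})" if pq: "(p, q) \<in> D" "(p, q) \<noteq> (i, j)" for p q
  proof -
    have d: "(p, q) \<in> diagonals V" using pq DD by blast
    have nc: "\<not> crossing (i, j) (p, q)" "\<not> crossing (p, q) (i, j)"
      using D pq(1) ij by (auto simp: dissection_def)
    have m: "j - i \<le> q - p" using min pq by blast
    have lt: "p < q" using d by (simp add: diagonals_iff)
    have p: "p \<notin> {i<..<j}" and q: "q \<notin> {i<..<j}"
      using nc m lt ijV by (auto simp: crossing_def)
    have "\<exists>x\<in>V - {i<..<j}. p < x \<and> x < q"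
    proof -
      obtain x where x: "x \<in> V" "p < x" "x < q" using d by (auto simp: diagonals_iff)
      show ?thesis
      proof (cases "x \<in> {i<..<j}")
        case True
        hence "p \<le> i" "j \<le> q" using p q x by auto
        with pq(2) have "p < i \<or> j < q" by auto
        thus ?thesis using ijV \<open>p \<le> i\<close> \<open>j \<le> q\<close> by (meson Diff_iff greaterThanLessThan_iff
              less_le_trans le_less_trans less_irrefl)
      qed (use x in auto)
    qed
    moreover have "\<exists>x\<in>V - {i<..<j}. x < p \<or> q < x"
    proof -
      obtain x where x: "x \<in> V" "x < p \<or> q < x" using d by (auto simp: diagonals_iff)
      show ?thesis
      proof (cases "x \<in> {i<..<j}")
        case True
        hence "i < p \<or> q < j" using p q x by auto
        thus ?thesis using ijV by auto
      qed (use x in auto)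
    qed
    ultimately show ?thesis using d p q by (auto simp: diagonals_iff)
  qed
  thus ?thesis using D unfolding dissection_def by auto
qed

text \<open>A cell avoiding the interior of the ear is a cell of the smaller polygon. A cell with a
  vertex strictly between \<open>i\<close> and \<open>j\<close> absorbs \<open>V\<close> from
  \<open>i\<close> to \<open>j\<close>, as its sides there can only be sides of \<open>V\<close>,
  and ends there because \<open>(i, j)\<close> must not cut it.\<close>

lemma cells_insert_ear:
  assumes V: "finite V" and ij: "(i, j) \<in> diagonals V"
    and D: "dissection (V - {i<..<j}) D"
  shows "cells V (insert (i, j) D) = insert (V \<inter> {i..j}) (cells (V - {i<..<j}) D)"
proof (intro equalityI subsetI)
  let ?V' = "V - {i<..<j}" and ?V1 = "V \<inter> {i..j}" and ?D = "insert (i, j) D"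
  have ijV: "i \<in> V" "j \<in> V" "i < j" using ij by (auto simp: diagonals_iff)
  obtain y where y: "y \<in> V" "i < y" "y < j" using ij by (auto simp: diagonals_iff)
  have DD: "D \<subseteq> diagonals ?V'" using D by (simp add: dissection_def)
  {
    fix C assume C: "C \<in> insert ?V1 (cells ?V' D)"
    show "C \<in> cells V ?D"
    proof (cases "C = ?V1")
      case True
      have "card {i, y, j} \<le> card ?V1" using ijV y V by (intro card_mono) auto
      hence "card ?V1 \<ge> 3" using y by simp
      moreover have "sides ?V1 \<subseteq> sides V \<union> {(i, j)}"
      proof (clarify)
        fix p q assume s: "(p, q) \<in> sides ?V1" "(p, q) \<notin> sides V"
        hence pq: "p \<in> ?V1" "q \<in> ?V1" "p < q" by (auto simp: sides_iff)
        show "p = i \<and> q = j"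
        proof (cases "\<forall>x\<in>?V1. \<not> (p < x \<and> x < q)")
          case True
          hence "\<forall>x\<in>V. \<not> (p < x \<and> x < q)" using pq by auto
          thus ?thesis using s pq by (auto simp: sides_iff)
        next
          case False
          hence "\<forall>x\<in>?V1. p \<le> x \<and> x \<le> q" using s(1) by (auto simp: sides_iff)
          thus ?thesis using pq ijV by (auto intro: antisym)
        qed
      qed
      moreover have "diagonals ?V1 \<inter> ?D = {}"
      proof -
        have False if "(p, q) \<in> diagonals ?V1" "(p, q) \<in> ?D" for p q
        proof (cases "(p, q) = (i, j)")
          case True thus ?thesis using that by (auto simp: diagonals_iff)
        next
          case False
          hence "(p, q) \<in> diagonals ?V'" using that DD by blast
          hence "p \<in> ?V'" "q \<in> ?V'" "p < q" by (auto simp: diagonals_iff)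
          moreover have "p \<in> ?V1" "q \<in> ?V1" using that by (auto simp: diagonals_iff)
          ultimately have "p = i \<and> q = j" by auto
          thus ?thesis using False by simp
        qed
        thus ?thesis by auto
      qed
      ultimately show ?thesis using True by (auto simp: cells_def)
    next
      case False
      hence C: "C \<in> cells ?V' D" using C by blast
      have "sides ?V' \<subseteq> sides V \<union> {(i, j)}"
      proof (clarify)
        fix p q assume s: "(p, q) \<in> sides ?V'" "(p, q) \<notin> sides V"
        hence pq: "p \<in> ?V'" "q \<in> ?V'" "p < q" by (auto simp: sides_iff)
        show "p = i \<and> q = j"
        proof (cases "\<forall>x\<in>?V'. p \<le> x \<and> x \<le> q")
          case True
          hence "p \<le> i" "j \<le> q" using ijV by auto
          hence "\<forall>x\<in>V. p \<le> x \<and> x \<le> q" using True by force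
          thus ?thesis using s pq by (auto simp: sides_iff)
        next
          case False
          hence n: "\<forall>x\<in>?V'. \<not> (p < x \<and> x < q)" using s(1) by (auto simp: sides_iff)
          obtain x where x: "x \<in> V" "p < x" "x < q" using s pq by (auto simp: sides_iff)
          hence "i < x" "x < j" using n by auto
          hence "p \<le> i" "j \<le> q" using pq x by auto
          moreover have "\<not> p < i" "\<not> j < q"
            using n ijV \<open>i < x\<close> \<open>x < j\<close> x by auto
          ultimately show ?thesis by auto
        qed
      qed
      moreover have "(i, j) \<notin> diagonals C" using C by (auto simp: cells_def diagonals_iff)
      ultimately show ?thesis using C by (auto simp: cells_def)
    qed
  }
  {
    fix C assume C: "C \<in> cells V ?D"
    hence CV: "C \<subseteq> V" and c3: "card C \<ge> 3" and sd: "sides C \<subseteq> sides V \<union> ?D"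
      and dg: "diagonals C \<inter> ?D = {}" by (auto simp: cells_def)
    have finC: "finite C" using CV V finite_subset by blast
    have in_V: "(p, q) \<in> sides V"
      if "(p, q) \<in> sides C" "p \<in> {i<..<j} \<or> q \<in> {i<..<j}" for p q
    proof -
      have "(p, q) \<notin> D" using that(2) DD by (auto simp: diagonals_iff)
      moreover have "(p, q) \<noteq> (i, j)" using that(2) by auto
      ultimately show ?thesis using that sd by blast
    qed
    have ex_mid: "\<exists>z\<in>C. z \<noteq> a \<and> z \<noteq> b" for a b
    proof (rule ccontr)
      assume "\<not> ?thesis"
      hence "card C \<le> card {a, b}" by (intro card_mono) auto
      also have "\<dots> \<le> 2" by (simp add: card_insert_if)
      finally show False using c3 by simp
    qed
    show "C \<in> insert ?V1 (cells ?V' D)"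
    proof (cases "C \<inter> {i<..<j} = {}")
      case True
      hence CV': "C \<subseteq> ?V'" using CV by blast
      have "sides C \<subseteq> sides ?V' \<union> D"
      proof (clarify)
        fix p q assume s: "(p, q) \<in> sides C" "(p, q) \<notin> D"
        have pq: "p \<in> ?V'" "q \<in> ?V'" "p < q" using s CV' by (auto simp: sides_iff)
        show "(p, q) \<in> sides ?V'"
        proof (cases "(p, q) = (i, j)")
          case True thus ?thesis using pq by (auto simp: sides_iff)
        next
          case False
          hence "(p, q) \<in> sides V" using s sd by blast
          thus ?thesis using pq by (auto simp: sides_iff)
        qed
      qed
      thus ?thesis using CV' c3 dg by (auto simp: cells_def)
    next
      case False
      then obtain x0 where x0: "x0 \<in> C" "i < x0" "x0 < j" by auto
      have Cne: "C \<noteq> {}" using x0 by auto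
      \<comment> \<open>Let \<open>p\<close> be the last vertex of \<open>C\<close> before the
        missed \<open>v\<close>. The side of \<open>C\<close> from \<open>p\<close> upwards skips
        \<open>v\<close>; if \<open>C\<close> ends at \<open>p\<close>, the closing side from
        \<open>Min C\<close> to \<open>p\<close> leaves out \<open>j\<close>. Neither can be a side
        of \<open>V\<close>.\<close>
      have up: "v \<in> C" if "v \<in> V" "v \<le> j" "x0 \<le> v" for v
      proof (rule ccontr)
        assume v: "v \<notin> C"
        define p where "p = Max {x\<in>C. x \<le> v}"
        have p: "p \<in> {x\<in>C. x \<le> v}" unfolding p_def by (rule Max_in) (use finC x0 that in auto)
        have pmax: "x \<le> p" if "x \<in> C" "x \<le> v" for x
          unfolding p_def using that finC by (intro Max_ge) auto
        have pv: "p < v" using p v by (auto simp: order.strict_iff_order)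
        have px0: "x0 \<le> p" using pmax x0 that by auto
        have pin: "p \<in> {i<..<j}" using px0 x0 pv that by auto
        show False
        proof (cases "\<exists>x\<in>C. v < x")
          case True
          define q where "q = Min {x\<in>C. v < x}"
          have q: "q \<in> {x\<in>C. v < x}" unfolding q_def by (rule Min_in) (use finC True in auto)
          have qmin: "q \<le> x" if "x \<in> C" "v < x" for x
            unfolding q_def using that finC by (intro Min_le) auto
          have "\<not> (p < x \<and> x < q)" if "x \<in> C" for x
            using pmax[OF that] qmin[OF that] by (meson not_le)
          hence "(p, q) \<in> sides C" using p q pv by (auto simp: sides_iff)
          hence "(p, q) \<in> sides V" using in_V pin by blast
          hence "(\<forall>x\<in>V. \<not> (p < x \<and> x < q)) \<or> (\<forall>x\<in>V. p \<le> x \<and> x \<le> q)"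
            by (simp add: sides_iff)
          thus False using that(1) pv q ijV(1) pin by fastforce
        next
          case False
          hence pM: "x \<le> p" if "x \<in> C" for x using pmax that by (meson not_le)
          define m where "m = Min C"
          have m: "m \<in> C" "\<And>x. x \<in> C \<Longrightarrow> m \<le> x" using finC Cne by (auto simp: m_def)
          obtain z where z: "z \<in> C" "z \<noteq> m" "z \<noteq> p" using ex_mid by blast
          have mz: "m < z" "z < p" using z m(2)[OF z(1)] pM[OF z(1)] by auto
          have "(m, p) \<in> sides C" using p m pM mz by (auto simp: sides_iff)
          hence "(m, p) \<in> sides V" using in_V pin by blast
          hence "(\<forall>x\<in>V. \<not> (m < x \<and> x < p)) \<or> (\<forall>x\<in>V. m \<le> x \<and> x \<le> p)"
            by (simp add: sides_iff)
          thus False using z(1) CV mz ijV(2) pin by fastforce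
        qed
      qed
      \<comment> \<open>The mirror image: now the closing side would run from \<open>p\<close> to
        \<open>Max C\<close> and leave out \<open>i\<close>.\<close>
      have down: "v \<in> C" if "v \<in> V" "i \<le> v" "v \<le> x0" for v
      proof (rule ccontr)
        assume v: "v \<notin> C"
        define p where "p = Min {x\<in>C. v \<le> x}"
        have p: "p \<in> {x\<in>C. v \<le> x}" unfolding p_def by (rule Min_in) (use finC x0 that in auto)
        have pmin: "p \<le> x" if "x \<in> C" "v \<le> x" for x
          unfolding p_def using that finC by (intro Min_le) auto
        have pv: "v < p" using p v by (auto simp: order.strict_iff_order)
        have px0: "p \<le> x0" using pmin x0 that by auto
        have pin: "p \<in> {i<..<j}" using px0 x0 pv that by auto
        show False
        proof (cases "\<exists>x\<in>C. x < v")
          case True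
          define q where "q = Max {x\<in>C. x < v}"
          have q: "q \<in> {x\<in>C. x < v}" unfolding q_def by (rule Max_in) (use finC True in auto)
          have qmax: "x \<le> q" if "x \<in> C" "x < v" for x
            unfolding q_def using that finC by (intro Max_ge) auto
          have "\<not> (q < x \<and> x < p)" if "x \<in> C" for x
            using pmin[OF that] qmax[OF that] by (meson not_le)
          hence "(q, p) \<in> sides C" using p q pv by (auto simp: sides_iff)
          hence "(q, p) \<in> sides V" using in_V pin by blast
          hence "(\<forall>x\<in>V. \<not> (q < x \<and> x < p)) \<or> (\<forall>x\<in>V. q \<le> x \<and> x \<le> p)"
            by (simp add: sides_iff)
          thus False using that(1) pv q ijV(2) pin by fastforce
        next
          case False
          hence pM: "p \<le> x" if "x \<in> C" for x using pmin that by (meson not_le)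
          define m where "m = Max C"
          have m: "m \<in> C" "\<And>x. x \<in> C \<Longrightarrow> x \<le> m" using finC Cne by (auto simp: m_def)
          obtain z where z: "z \<in> C" "z \<noteq> m" "z \<noteq> p" using ex_mid by blast
          have mz: "z < m" "p < z" using z m(2)[OF z(1)] pM[OF z(1)] by auto
          have "(p, m) \<in> sides C" using p m pM mz by (auto simp: sides_iff)
          hence "(p, m) \<in> sides V" using in_V pin by blast
          hence "(\<forall>x\<in>V. \<not> (p < x \<and> x < m)) \<or> (\<forall>x\<in>V. p \<le> x \<and> x \<le> m)"
            by (simp add: sides_iff)
          thus False using z(1) CV mz ijV(1) pin by fastforce
        qed
      qed
      have sub: "?V1 \<subseteq> C"
      proof
        fix v assume "v \<in> ?V1"
        thus "v \<in> C" using up[of v] down[of v] by (cases "v \<le> x0") auto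
      qed
      have "(i, j) \<notin> diagonals C" using dg by blast
      moreover have "i \<in> C" "j \<in> C" using sub ijV by auto
      ultimately have "\<forall>x\<in>C. i \<le> x \<and> x \<le> j"
        using ijV x0 by (auto simp: diagonals_iff not_less)
      thus ?thesis using sub CV by auto
    qed
  }
qed

section \<open>Quiddities as words closed under ear insertion\<close>

text \<open>A block of \<open>3 * k + 1\<close> new vertices makes an ear with
  \<open>3 * k + 3\<close> vertices. The closing side from the last to the first entry never
  receives a block, because the ear cut off by \<open>(i, j)\<close> is the part between
  \<open>i\<close> and \<open>j\<close>.\<close>

inductive_set ear_words :: "nat list set" where
  base: "replicate (3 * k + 3) 1 \<in> ear_words"
| step: "xs @ a # b # ys \<in> ear_words \<Longrightarrow>
    xs @ Suc a # replicate (3 * k + 1) 1 @ Suc b # ys \<in> ear_words"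

lemma length_ear_words: "w \<in> ear_words \<Longrightarrow> length w \<ge> 3"
  by (induction rule: ear_words.induct) auto

section \<open>Quiddities of 3-periodic dissections are the ear words\<close>

text \<open>A quiddity over an arbitrary vertex list: after an ear is removed the labels are no
  longer consecutive.\<close>

definition cell_counts :: "nat set \<Rightarrow> (nat \<times> nat) set \<Rightarrow> nat list \<Rightarrow> nat list" where
  "cell_counts V D vs = map (\<lambda>i. card {C \<in> cells V D. i \<in> C}) vs"

lemma card_insert_containing:
  assumes "finite K" "E \<notin> K"
  shows "card {C \<in> insert E K. v \<in> C} =
    (if v \<in> E then Suc (card {C \<in> K. v \<in> C}) else card {C \<in> K. v \<in> C})"
proof -
  have "{C \<in> insert E K. v \<in> C} =
      (if v \<in> E then insert E {C \<in> K. v \<in> C} else {C \<in> K. v \<in> C})"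
    by auto
  thus ?thesis using assms by simp
qed

text \<open>Only the ear contains the vertices \<open>ms\<close>; it adds one to the counts of
  \<open>i\<close> and \<open>j\<close> and changes no others. The vertices inside and outside the
  ear make \<open>(i, j)\<close> a diagonal rather than a side.\<close>

lemma cell_counts_insert_ear:
  assumes vs: "sorted_wrt (<) (as @ i # ms @ j # bs)" and ms: "ms \<noteq> []" and ab: "as \<noteq> [] \<or> bs \<noteq> []"
    and D: "dissection (set (as @ i # j # bs)) D"
  defines "V \<equiv> set (as @ i # ms @ j # bs)" and "V' \<equiv> set (as @ i # j # bs)"
  shows "(i, j) \<in> diagonals V"
    and "dissection V (insert (i, j) D)"
    and "cells V (insert (i, j) D) = insert (set (i # ms @ [j])) (cells V' D)"
    and "card (set (i # ms @ [j])) = length ms + 2"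
    and "cell_counts V (insert (i, j) D) (as @ i # ms @ j # bs) =
      (let f = (\<lambda>i. card {C \<in> cells V' D. i \<in> C})
       in map f as @ Suc (f i) # replicate (length ms) 1 @ Suc (f j) # map f bs)"
proof -
  have fin: "finite V" "finite V'" by (simp_all add: V_def V'_def)
  have ord: "i < j" "\<And>x. x \<in> set as \<Longrightarrow> x < i" "\<And>x. x \<in> set ms \<Longrightarrow> i < x \<and> x < j"
    "\<And>x. x \<in> set bs \<Longrightarrow> j < x"
    using vs by (auto simp: sorted_wrt_append)
  have V': "V - {i<..<j} = V'" and V1: "V \<inter> {i..j} = set (i # ms @ [j])"
    unfolding V_def V'_def using ord(1) by (auto dest: ord(2-4))
  show ij: "(i, j) \<in> diagonals V"
  proof -
    obtain x where "x \<in> set ms" using ms by (meson last_in_set)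
    moreover obtain y where "y \<in> set as \<or> y \<in> set bs" using ab by (meson last_in_set)
    ultimately show ?thesis unfolding diagonals_iff V_def using ord by fastforce
  qed
  show "dissection V (insert (i, j) D)"
    using dissection_insert_ear[OF fin(1) ij] D V' V'_def by simp
  show c: "cells V (insert (i, j) D) = insert (set (i # ms @ [j])) (cells V' D)"
    using cells_insert_ear[OF fin(1) ij] D V' V'_def V1 by simp
  have "distinct (as @ i # ms @ j # bs)" using vs strict_sorted_iff by blast
  hence dist: "distinct (i # ms @ [j])" by auto
  show "card (set (i # ms @ [j])) = length ms + 2"
    using distinct_card[OF dist] by simp
  let ?K = "cells V' D" and ?E = "set (i # ms @ [j])"
  have EK: "?E \<notin> ?K"
  proof
    assume "?E \<in> ?K"
    hence "set ms \<subseteq> V'" by (auto simp: cells_def)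
    moreover have "set ms \<inter> V' = {}" using \<open>distinct (as @ i # ms @ j # bs)\<close> by (auto simp: V'_def)
    ultimately show False using ms by (metis inf.absorb_iff1 set_empty)
  qed
  have finK: "finite ?K" using finite_cells fin by blast
  note cnt = card_insert_containing[OF finK EK]
  have zero: "{C \<in> ?K. v \<in> C} = {}" if "v \<in> set ms" for v
    using that \<open>distinct (as @ i # ms @ j # bs)\<close> by (auto simp: cells_def V'_def)
  have "map (\<lambda>v. card {C \<in> insert ?E ?K. v \<in> C}) ms = replicate (length ms) 1"
  proof -
    have "card {C \<in> insert ?E ?K. v \<in> C} = 1" if "v \<in> set ms" for v
      unfolding cnt zero[OF that] using that by simp
    thus ?thesis by (simp only: map_replicate_const[symmetric] cong: map_cong)
  qed
  moreover have "card {C \<in> insert ?E ?K. v \<in> C} = card {C \<in> ?K. v \<in> C}"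
    if "v \<in> set as \<union> set bs" for v
  proof -
    have "v \<notin> ?E" using that \<open>distinct (as @ i # ms @ j # bs)\<close> by auto
    thus ?thesis unfolding cnt by simp
  qed
  hence "map (\<lambda>v. card {C \<in> insert ?E ?K. v \<in> C}) as = map (\<lambda>v. card {C \<in> ?K. v \<in> C}) as"
    "map (\<lambda>v. card {C \<in> insert ?E ?K. v \<in> C}) bs = map (\<lambda>v. card {C \<in> ?K. v \<in> C}) bs"
    by (intro map_cong; blast)+
  moreover have "card {C \<in> insert ?E ?K. v \<in> C} = Suc (card {C \<in> ?K. v \<in> C})"
    if "v = i \<or> v = j" for v
    unfolding cnt using that by auto
  ultimately show "cell_counts V (insert (i, j) D) (as @ i # ms @ j # bs) =
      (let f = (\<lambda>i. card {C \<in> cells V' D. i \<in> C})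
       in map f as @ Suc (f i) # replicate (length ms) 1 @ Suc (f j) # map f bs)"
    by (simp only: cell_counts_def c Let_def map_append list.map simp_thms)
qed

text \<open>Induction on the number of vertices: a diagonal of least span cuts off an ear that is
  itself a cell, and its removal leaves a 3-periodic dissection of a smaller polygon.\<close>

lemma cell_counts_in_ear_words:
  assumes "sorted_wrt (<) vs" "length vs \<ge> 3" "three_periodic (set vs) D"
  shows "cell_counts (set vs) D vs \<in> ear_words"
  using assms
proof (induction "length vs" arbitrary: vs D rule: less_induct)
  case less
  let ?V = "set vs"
  have dist: "distinct vs" using less.prems strict_sorted_iff by blast
  have dis: "dissection ?V D" and per: "\<And>C. C \<in> cells ?V D \<Longrightarrow> 3 dvd card C"
    using less.prems by (auto simp: three_periodic_def)
  show ?case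
  proof (cases "D = {}")
    case True
    have c: "cells ?V D = {?V}"
      using cells_empty[of ?V] less.prems dist by (simp add: True distinct_card)
    hence "3 dvd length vs" using per[of ?V] dist by (simp add: distinct_card)
    then obtain m where m: "length vs = 3 * m" by auto
    define k where "k = m - 1"
    have k: "length vs = 3 * k + 3" using less.prems(2) m by (auto simp: k_def)
    have "card {C \<in> {?V}. v \<in> C} = 1" if "v \<in> ?V" for v
    proof -
      have "{C \<in> {?V}. v \<in> C} = {?V}" using that by auto
      thus ?thesis by simp
    qed
    hence "cell_counts ?V D vs = replicate (length vs) 1"
      by (simp add: cell_counts_def c flip: map_replicate_const cong: map_cong)
    thus ?thesis using ear_words.base[of k] k by simp
  next
    case False
    then obtain d0 where "d0 \<in> D" by blast
    then obtain d where d: "d \<in> D" and dmin: "\<And>e. e \<in> D \<Longrightarrow> snd d - fst d \<le> snd e - fst e"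
      using ex_has_least_nat[of "\<lambda>d. d \<in> D" d0 "\<lambda>d. snd d - fst d"] by blast
    obtain i j where dij: "d = (i, j)" by fastforce
    have ij: "(i, j) \<in> D" using d dij by simp
    have dia: "(i, j) \<in> diagonals ?V" using ij dis by (auto simp: dissection_def)
    have iV: "i \<in> ?V" and jV: "j \<in> ?V" and lt: "i < j" using dia by (auto simp: diagonals_iff)
    obtain as cs where 1: "vs = as @ i # cs" using iV by (meson split_list)
    have "j \<in> set cs" using 1 jV lt less.prems(1) by (auto simp: sorted_wrt_append)
    then obtain ms bs where 2: "cs = ms @ j # bs" by (meson split_list)
    have vs: "vs = as @ i # ms @ j # bs" using 1 2 by simp
    have V': "?V - {i<..<j} = set (as @ i # j # bs)"
      using less.prems(1) unfolding vs by (force simp: sorted_wrt_append)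
    have ms: "ms \<noteq> []"
      using dia less.prems(1) unfolding vs by (auto simp: diagonals_iff sorted_wrt_append)
    have ab: "as \<noteq> [] \<or> bs \<noteq> []"
    proof (rule ccontr)
      assume "\<not> (as \<noteq> [] \<or> bs \<noteq> [])"
      hence "\<forall>x\<in>?V. i \<le> x \<and> x \<le> j"
        using less.prems(1) lt unfolding vs by (auto simp: sorted_wrt_append intro: less_imp_le)
      thus False using dia by (meson diagonals_iff not_le)
    qed
    define D' where "D' = D - {(i, j)}"
    have DD: "D = insert (i, j) D'" using ij by (auto simp: D'_def)
    have dis': "dissection (set (as @ i # j # bs)) D'"
      unfolding D'_def V'[symmetric]
      by (rule dissection_remove_ear[OF _ dis ij]) (use dmin dij in force)+
    note ear = cell_counts_insert_ear[OF less.prems(1)[unfolded vs] ms ab dis', folded DD vs]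
    let ?vs' = "as @ i # j # bs"
    have "three_periodic (set ?vs') D'"
      using dis' per ear(3) by (auto simp: three_periodic_def)
    moreover have "length ?vs' < length vs" using ms by (simp add: vs)
    moreover have "length ?vs' \<ge> 3" using ab by (cases as; cases bs) auto
    moreover have "sorted_wrt (<) ?vs'" using less.prems(1) by (auto simp: vs sorted_wrt_append)
    ultimately have IH: "cell_counts (set ?vs') D' ?vs' \<in> ear_words" using less.hyps by blast
    have "3 dvd length ms + 2" using per[of "set (i # ms @ [j])"] ear(3,4) by simp
    then obtain m where m: "length ms + 2 = 3 * m" by (auto elim: dvdE)
    hence k: "length ms = 3 * (m - 1) + 1" by (cases m) auto
    from IH show ?thesis
      unfolding ear(5) Let_def k by (intro ear_words.step) (simp add: cell_counts_def)
  qed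
qed

text \<open>The vertex list is arbitrary, so that the induction hypothesis applies to the vertices
  left when the block \<open>ms\<close> is omitted; the ear on \<open>(i, j)\<close> is then glued
  on.\<close>

lemma ear_words_realised:
  assumes "w \<in> ear_words" "sorted_wrt (<) vs" "length vs = length w"
  shows "\<exists>D. three_periodic (set vs) D \<and> cell_counts (set vs) D vs = w"
  using assms
proof (induction arbitrary: vs rule: ear_words.induct)
  case (base k)
  have dist: "distinct vs" using base strict_sorted_iff by blast
  have c: "cells (set vs) {} = {set vs}"
    using base dist by (intro cells_empty) (simp_all add: distinct_card)
  have "card {C \<in> {set vs}. v \<in> C} = 1" if "v \<in> set vs" for v
  proof -
    have "{C \<in> {set vs}. v \<in> C} = {set vs}" using that by auto
    thus ?thesis by simp
  qed
  hence "cell_counts (set vs) {} vs = replicate (length vs) 1"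
    by (simp add: cell_counts_def c flip: map_replicate_const cong: map_cong)
  moreover have "three_periodic (set vs) {}"
    using dist base by (simp add: three_periodic_def dissection_empty c distinct_card)
  moreover have "length vs = 3 * k + 3" using base by simp
  ultimately show ?case by metis
next
  case (step xs a b ys k)
  define as where "as = take (length xs) vs"
  obtain i r where r: "drop (length xs) vs = i # r"
    using step.prems(2) by (cases "drop (length xs) vs") auto
  define ms where "ms = take (3 * k + 1) r"
  have lr: "length r = 3 * k + 1 + Suc (length ys)"
    using arg_cong[OF r, of length] step.prems(2) by simp
  obtain j bs where bs: "drop (3 * k + 1) r = j # bs"
    using lr by (cases "drop (3 * k + 1) r") auto
  have "r = ms @ j # bs" unfolding ms_def by (metis append_take_drop_id bs)
  hence vs: "vs = as @ i # ms @ j # bs" unfolding as_def by (metis append_take_drop_id r)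
  have len: "length as = length xs" "length ms = 3 * k + 1" "length bs = length ys"
    using step.prems(2) lr arg_cong[OF bs, of length] by (auto simp: as_def ms_def)
  let ?vs' = "as @ i # j # bs"
  have "sorted_wrt (<) ?vs'" using step.prems(1) by (auto simp: vs sorted_wrt_append)
  moreover have "length ?vs' = length (xs @ a # b # ys)" using len by simp
  ultimately obtain D where D: "three_periodic (set ?vs') D"
    "cell_counts (set ?vs') D ?vs' = xs @ a # b # ys" using step.IH by blast
  have ms: "ms \<noteq> []" using len by auto
  have ab: "as \<noteq> [] \<or> bs \<noteq> []" using length_ear_words[OF step.hyps] len by auto
  have dis: "dissection (set ?vs') D" using D by (simp add: three_periodic_def)
  note ear = cell_counts_insert_ear[OF step.prems(1)[unfolded vs] ms ab dis, folded vs]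
  have "three_periodic (set vs) (insert (i, j) D)"
  proof -
    have "3 dvd card (set (i # ms @ [j]))" using ear(4) len(2) by presburger
    moreover have "\<forall>C\<in>cells (set ?vs') D. 3 dvd card C" using D(1) unfolding three_periodic_def by blast
    ultimately have "\<forall>C\<in>cells (set vs) (insert (i, j) D). 3 dvd card C"
      unfolding ear(3) by (simp only: ball_simps simp_thms)
    thus ?thesis using ear(2) unfolding three_periodic_def by blast
  qed
  moreover have "cell_counts (set vs) (insert (i, j) D) vs =
      xs @ Suc a # replicate (3 * k + 1) 1 @ Suc b # ys"
  proof -
    let ?f = "\<lambda>i. card {C \<in> cells (set ?vs') D. i \<in> C}"
    have "map ?f as @ ?f i # ?f j # map ?f bs = xs @ a # b # ys"
      using D(2) by (simp only: cell_counts_def map_append list.map)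
    hence "map ?f as = xs \<and> ?f i # ?f j # map ?f bs = a # b # ys"
      by (subst (asm) append_eq_append_conv) (simp add: len(1))
    thus ?thesis unfolding ear(5) Let_def len(2) by (simp only: list.inject simp_thms)
  qed
  ultimately show ?case by blast
qed

lemma quiddities_eq_ear_words:
  assumes "n \<ge> 1"
  shows "{quiddity n D |D. three_periodic {0..n+1} D} = {w \<in> ear_words. length w = n + 2}"
proof -
  have vs: "set [0..<n+2] = {0..n+1}" "sorted_wrt (<) [0..<n+2]"
    by (auto simp: sorted_wrt_upt simp del: upt_Suc)
  have q: "quiddity n D = cell_counts {0..n+1} D [0..<n+2]" for D
    by (simp add: quiddity_def cell_counts_def)
  show ?thesis
  proof (intro equalityI subsetI)
    fix w assume "w \<in> {quiddity n D |D. three_periodic {0..n+1} D}"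
    thus "w \<in> {w \<in> ear_words. length w = n + 2}"
      using cell_counts_in_ear_words[OF vs(2), unfolded vs(1)] assms
      by (auto simp: q simp del: upt_Suc) (simp add: cell_counts_def)
  next
    fix w assume "w \<in> {w \<in> ear_words. length w = n + 2}"
    thus "w \<in> {quiddity n D |D. three_periodic {0..n+1} D}"
      using ear_words_realised[OF _ vs(2), of w, unfolded vs(1)] by (force simp: q simp del: upt_Suc)
  qed
qed

section \<open>Words of dissection trees\<close>

text \<open>
  A tree encodes a dissected polygon with a distinguished base side: \<open>Node []\<close> is a single
  side, and \<open>Node ts\<close> is a cell whose sides other than the base carry the polygons \<open>ts\<close>, from left
  to right.
\<close>

datatype tree = Node "tree list"

fun edges :: "tree \<Rightarrow> nat" where
  "edges (Node []) = 1"
| "edges (Node (t # ts)) = sum_list (map edges (t # ts))"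

text \<open>The number of cells at the leftmost vertex: only the cells along the chain of first
  children reach it.\<close>

fun left_count :: "tree \<Rightarrow> nat" where
  "left_count (Node []) = 0"
| "left_count (Node (t # ts)) = Suc (left_count t)"

text \<open>The number of cells at the left end of the row \<open>ts\<close>, not counting the cell
  that carries the row; for an empty row it is the contribution \<open>x\<close> from
  outside.\<close>

fun next_count :: "tree list \<Rightarrow> nat \<Rightarrow> nat" where
  "next_count [] x = x"
| "next_count (t # ts) x = left_count t"

text \<open>
  \<open>word t x u\<close> lists the cell counts at all vertices of \<open>t\<close> but the leftmost one; \<open>x\<close> is added at
  the rightmost vertex, and \<open>u\<close> is what follows. \<open>words ts x u\<close> does the same for the polygons \<open>ts\<close>
  on consecutive sides of one cell, which itself adds one at each vertex.
\<close>

fun word :: "tree \<Rightarrow> nat \<Rightarrow> nat list \<Rightarrow> nat list"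
  and words :: "tree list \<Rightarrow> nat \<Rightarrow> nat list \<Rightarrow> nat list" where
  "word (Node []) x u = x # u"
| "word (Node (t # ts)) x u = words (t # ts) x u"
| "words [] x u = u"
| "words (t # ts) x u = word t (Suc (next_count ts x)) (words ts x u)"

lemma word_Node: "ts \<noteq> [] \<Longrightarrow> word (Node ts) x u = words ts x u"
  by (cases ts) auto

lemma left_count_Node: "ts \<noteq> [] \<Longrightarrow> left_count (Node ts) = Suc (next_count ts x)"
  by (cases ts) auto

lemma edges_Node: "ts \<noteq> [] \<Longrightarrow> edges (Node ts) = sum_list (map edges ts)"
  by (cases ts) auto

lemma next_count_append: "next_count (ts @ ts') x = next_count ts (next_count ts' x)"
  by (cases ts) auto

lemma words_append: "words (ts @ ts') x u = words ts (next_count ts' x) (words ts' x u)"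
  by (induction ts) (auto simp: next_count_append)

lemma edges_pos: "edges t \<ge> 1"
  by (induction t rule: edges.induct) (auto simp: Suc_le_eq)

lemma sum_edges_ge_length: "length ts \<le> sum_list (map edges ts)"
proof (induction ts)
  case (Cons t ts)
  thus ?case using edges_pos[of t] by simp
qed simp

text \<open>Makes the dependence on the context explicit: \<open>x\<close> enters only the last
  entry and \<open>u\<close> is only appended.\<close>

lemma word_shape: "\<exists>I r. Suc (length I) = edges t \<and> (\<forall>x u. word t x u = I @ (r + x) # u)"
proof (induction t)
  case (Node ts)
  show ?case
  proof (cases "ts = []")
    case True
    thus ?thesis by (intro exI[of _ "[]"] exI[of _ 0]) auto
  next
    case False
    have "\<exists>I r. Suc (length I) = sum_list (map edges ts) \<and> (\<forall>x u. words ts x u = I @ (r + x) # u)"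
      using False Node
    proof (induction ts)
      case (Cons t ts)
      obtain I r where 1: "Suc (length I) = edges t" "\<And>x u. word t x u = I @ (r + x) # u"
        using Cons.prems(2)[of t] by auto
      show ?case
      proof (cases "ts = []")
        case True
        thus ?thesis using 1 by (intro exI[of _ I] exI[of _ "Suc r"]) auto
      next
        case False
        then obtain I' r' where 2: "Suc (length I') = sum_list (map edges ts)"
          "\<And>x u. words ts x u = I' @ (r' + x) # u" using Cons by auto
        \<comment> \<open>The middle entry belongs to the vertex shared by \<open>t\<close> and the
          next tree; as \<open>ts\<close> is nonempty, \<open>next_count\<close> there has the same
          value for every default, such as \<open>0\<close>.\<close>
        show ?thesis
          using 1 2 False
          by (intro exI[of _ "I @ (r + Suc (next_count ts 0)) # I'"] exI[of _ r'])
            (cases ts; auto simp flip: 1(1) 2(1))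
      qed
    qed simp
    thus ?thesis using False by (simp add: word_Node edges_Node)
  qed
qed

lemma length_word: "length (word t x u) = edges t + length u"
proof -
  obtain I r where "Suc (length I) = edges t" "\<And>x u. word t x u = I @ (r + x) # u"
    using word_shape by blast
  thus ?thesis by (simp flip: \<open>Suc (length I) = edges t\<close>)
qed

lemma length_words: "length (words ts x u) = sum_list (map edges ts) + length u"
  by (induction ts) (auto simp: length_word)

section \<open>Dissection trees yield exactly the ear words\<close>

text \<open>The first entry is the left end of the base, which \<open>words\<close> omits; the
  contribution at the right end is \<open>0\<close> because nothing lies beyond the base.\<close>

definition root_word :: "tree list \<Rightarrow> nat list" where
  "root_word ts = Suc (next_count ts 0) # words ts 0 []"

text \<open>A cell has its base besides the sides carrying \<open>ts\<close>, so the condition says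
  that its number of vertices is divisible by 3.\<close>

fun periodic :: "tree \<Rightarrow> bool" where
  "periodic (Node ts) \<longleftrightarrow> (ts = [] \<or> length ts mod 3 = 2) \<and> (\<forall>t\<in>set ts. periodic t)"

text \<open>The trees are glued onto an empty cell from left to right. The claim \<open>list\<close>
  passes from trees to rows; \<open>tree\<close> inserts an empty cell as one ear and applies
  \<open>list\<close> to its children, by structural induction.\<close>

lemma words_in_ear_words:
  assumes "\<forall>t\<in>set ts. periodic t" "ts \<noteq> []"
    and "xs @ a # replicate (length ts - 1) 1 @ Suc b # ys \<in> ear_words"
  shows "xs @ (a + next_count ts b) # words ts b ys \<in> ear_words"
proof -
  have list: "xs @ (a + next_count ts b) # words ts b ys \<in> ear_words"
    if "\<forall>t\<in>set ts. \<forall>xs a b ys. xs @ a # b # ys \<in> ear_words \<longrightarrow>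
         xs @ (a + left_count t) # word t b ys \<in> ear_words"
      and "ts \<noteq> []" "xs @ a # replicate (length ts - 1) 1 @ Suc b # ys \<in> ear_words"
    for ts xs a b ys
    using that
  proof (induction ts arbitrary: xs a)
    case (Cons t ts)
    show ?case
    proof (cases "ts = []")
      case True
      thus ?thesis using Cons.prems(1,3) by simp
    next
      case False
      define rest where "rest = replicate (length ts - 1) 1 @ Suc b # ys"
      obtain I r where w: "\<And>x u. word t x u = I @ (r + x) # u" using word_shape by blast
      have "xs @ a # 1 # rest \<in> ear_words"
        using Cons.prems(3) False by (cases ts) (auto simp: rest_def)
      hence "xs @ (a + left_count t) # word t 1 rest \<in> ear_words" using Cons.prems(1) by simp
      hence "(xs @ (a + left_count t) # I) @ (r + 1) # rest \<in> ear_words" by (simp add: w)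
      hence "(xs @ (a + left_count t) # I) @ ((r + 1) + next_count ts b) # words ts b ys \<in> ear_words"
        using Cons.prems(1) False
        by (intro Cons.IH[of "xs @ (a + left_count t) # I" "r + 1"]) (simp_all add: rest_def)
      thus ?thesis by (simp add: w)
    qed
  qed simp
  have tree: "periodic t \<Longrightarrow> xs @ a # b # ys \<in> ear_words \<Longrightarrow>
      xs @ (a + left_count t) # word t b ys \<in> ear_words" for t xs a b ys
  proof (induction t arbitrary: xs a b ys)
    case (Node ts)
    show ?case
    proof (cases "ts = []")
      case True
      thus ?thesis using Node.prems by simp
    next
      case False
      hence "length ts mod 3 = 2" using Node.prems by auto
      hence "length ts - 1 = 3 * (length ts div 3) + 1" by presburger
      then obtain k where k: "length ts - 1 = 3 * k + 1" by blast
      have "xs @ Suc a # replicate (length ts - 1) 1 @ Suc b # ys \<in> ear_words"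
        unfolding k by (rule ear_words.step[OF Node.prems(2)])
      hence "xs @ (Suc a + next_count ts b) # words ts b ys \<in> ear_words"
        using Node.IH Node.prems(1) False by (intro list) auto
      thus ?thesis using False by (simp add: word_Node left_count_Node[of ts b])
    qed
  qed
  show ?thesis using list tree assms by blast
qed

lemma root_word_in_ear_words:
  assumes "periodic (Node ts)" "ts \<noteq> []"
  shows "root_word ts \<in> ear_words"
proof -
  have "length ts mod 3 = 2" using assms by auto
  hence "length ts = 3 * (length ts div 3) + 2" by presburger
  then obtain k where k: "length ts = 3 * k + 2" by blast
  \<comment> \<open>The empty root cell, with \<open>a = 1\<close> at the left end of the base and
    outside contribution \<open>b = 0\<close> at the right end.\<close>
  have "[] @ 1 # replicate (length ts - 1) 1 @ Suc 0 # [] = replicate (3 * k + 3) (1::nat)"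
    using k by (simp add: replicate_append_same flip: replicate_Suc numeral_eq_Suc)
  hence "[] @ 1 # replicate (length ts - 1) 1 @ Suc 0 # [] \<in> ear_words"
    using ear_words.base[of k] by simp
  from words_in_ear_words[OF _ assms(2) this] assms(1) show ?thesis
    by (simp add: root_word_def)
qed

text \<open>Inserting a block replaces the trivial polygon on one side by a cell with
  \<open>3 * k + 2\<close> trivial children. The length of \<open>xs\<close> tells which side it is
  and steers the descent; elsewhere all rows keep their lengths.\<close>

lemma graft_ear:
  assumes "\<forall>t\<in>set ts. periodic t"
    and "(a + next_count ts b) # words ts b ys = xs @ p # q # zs"
    and "length xs < sum_list (map edges ts)"
  shows "\<exists>ts'. length ts' = length ts \<and> (\<forall>t\<in>set ts'. periodic t) \<and>
      (a + next_count ts' b) # words ts' b ys = xs @ Suc p # replicate (3 * k + 1) 1 @ Suc q # zs"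
proof -
  let ?ear = "\<lambda>xs p q zs. xs @ Suc p # replicate (3 * k + 1) 1 @ Suc q # zs"
  have list: "\<exists>ts'. length ts' = length ts \<and> (\<forall>t\<in>set ts'. periodic t) \<and>
      (a + next_count ts' b) # words ts' b ys = ?ear xs p q zs"
    if "\<forall>t\<in>set ts. \<forall>a b ys xs p q zs. (a + left_count t) # word t b ys = xs @ p # q # zs \<longrightarrow>
          length xs < edges t \<longrightarrow>
          (\<exists>t'. periodic t' \<and> (a + left_count t') # word t' b ys = ?ear xs p q zs)"
      and "\<forall>t\<in>set ts. periodic t" "(a + next_count ts b) # words ts b ys = xs @ p # q # zs"
        "length xs < sum_list (map edges ts)"
    for ts a b ys xs p q zs
    using that
  proof (induction ts arbitrary: a xs)
    case (Cons t ts)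
    have eq: "(a + left_count t) # word t (Suc (next_count ts b)) (words ts b ys) = xs @ p # q # zs"
      using Cons.prems(3) by simp
    show ?case
    proof (cases "length xs < edges t")
      case True
      obtain t' where t': "periodic t'"
        "(a + left_count t') # word t' (Suc (next_count ts b)) (words ts b ys) = ?ear xs p q zs"
        using Cons.prems(1) eq True by (meson list.set_intros(1))
      thus ?thesis using Cons.prems(2) by (intro exI[of _ "t' # ts"]) auto
    next
      case False
      obtain I r where I: "Suc (length I) = edges t" and w: "\<And>x u. word t x u = I @ (r + x) # u"
        using word_shape by blast
      let ?pre = "(a + left_count t) # I"
      have eq': "?pre @ (Suc r + next_count ts b) # words ts b ys = xs @ p # q # zs"
        using eq by (simp add: w)
      have "take (length ?pre) (xs @ p # q # zs) = ?pre" unfolding eq'[symmetric] by simp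
      moreover have "length ?pre \<le> length xs" using False I by simp
      ultimately have "take (length ?pre) xs = ?pre" by simp
      then obtain xs' where xs': "xs = ?pre @ xs'" by (metis append_take_drop_id)
      have eq'': "(Suc r + next_count ts b) # words ts b ys = xs' @ p # q # zs"
        using eq' unfolding xs' by simp
      have len: "length xs' < sum_list (map edges ts)"
        using Cons.prems(4) unfolding xs' by (simp flip: I)
      have "\<exists>ts'. length ts' = length ts \<and> (\<forall>t\<in>set ts'. periodic t) \<and>
          (Suc r + next_count ts' b) # words ts' b ys = ?ear xs' p q zs"
        by (rule Cons.IH[OF _ _ eq'' len]) (use Cons.prems(1,2) in simp_all)
      then obtain ts' where "length ts' = length ts" "\<forall>t\<in>set ts'. periodic t"
        "(Suc r + next_count ts' b) # words ts' b ys = ?ear xs' p q zs"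
        by blast
      thus ?thesis using Cons.prems(2)
        by (intro exI[of _ "t # ts'"]) (auto simp: w xs')
    qed
  qed simp
  have tree: "\<exists>t'. periodic t' \<and> (a + left_count t') # word t' b ys = ?ear xs p q zs"
    if "periodic t" "(a + left_count t) # word t b ys = xs @ p # q # zs" "length xs < edges t"
    for t a b ys xs p q zs
    using that
  proof (induction t arbitrary: a b ys xs p q zs)
    case (Node ts)
    show ?case
    proof (cases "ts = []")
      case True
      have "words (replicate (Suc m) (Node [])) b ys = replicate m 1 @ Suc b # ys" for m
        by (induction m) auto
      from this[of "3 * k + 1"]
      have "word (Node (replicate (3 * k + 2) (Node []))) b ys = replicate (3 * k + 1) 1 @ Suc b # ys"
        by (subst word_Node) auto
      moreover have "left_count (Node (replicate (3 * k + 2) (Node []))) = 1" by simp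
      moreover have "periodic (Node (replicate (3 * k + 2) (Node [])))" by simp presburger
      moreover have "xs = []" "p = a" "q = b" "zs = ys" using True Node.prems by auto
      ultimately show ?thesis by (metis Suc_eq_plus1 append_Nil)
    next
      case False
      have "\<exists>ts'. length ts' = length ts \<and> (\<forall>t\<in>set ts'. periodic t) \<and>
        (Suc a + next_count ts' b) # words ts' b ys = ?ear xs p q zs"
      proof (rule list)
        show "(Suc a + next_count ts b) # words ts b ys = xs @ p # q # zs"
          using Node.prems(2) False by (simp add: word_Node left_count_Node[of ts b])
        show "length xs < sum_list (map edges ts)" using Node.prems(3) False by (simp add: edges_Node)
        show "\<forall>t\<in>set ts. periodic t" using Node.prems(1) by simp
        thus "\<forall>t\<in>set ts. \<forall>a b ys xs p q zs.
            (a + left_count t) # word t b ys = xs @ p # q # zs \<longrightarrow> length xs < edges t \<longrightarrow>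
            (\<exists>t'. periodic t' \<and> (a + left_count t') # word t' b ys = ?ear xs p q zs)"
          using Node.IH by blast
      qed
      then obtain ts' where ts': "length ts' = length ts" "\<forall>t\<in>set ts'. periodic t"
        "(Suc a + next_count ts' b) # words ts' b ys = ?ear xs p q zs" by blast
      hence "ts' \<noteq> []" using False by auto
      thus ?thesis using ts' Node.prems(1) False
        by (intro exI[of _ "Node ts'"]) (simp add: word_Node left_count_Node[of ts' b])
    qed
  qed
  show ?thesis by (rule list) (use tree assms in blast)+
qed

lemma ear_word_is_root_word:
  assumes "w \<in> ear_words"
  shows "\<exists>ts. ts \<noteq> [] \<and> periodic (Node ts) \<and> root_word ts = w"
  using assms
proof induction
  case (base k)
  have w: "words (replicate (Suc m) (Node [])) 0 [] = replicate (Suc m) 1" for m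
    by (induction m) auto
  have "root_word (replicate (3 * k + 2) (Node [])) = replicate (3 * k + 3) 1"
  proof -
    have "3 * k + 3 = Suc (Suc (3 * k + 1))" "3 * k + 2 = Suc (3 * k + 1)" by simp_all
    thus ?thesis using w[of "3 * k + 1"] unfolding root_word_def by (simp only:) simp
  qed
  moreover have "periodic (Node (replicate (3 * k + 2) (Node [])))" by simp presburger
  ultimately show ?case by (metis replicate_empty add_2_eq_Suc' nat.simps(3))
next
  case (step xs a b ys k)
  then obtain ts where ts: "ts \<noteq> []" "periodic (Node ts)" "root_word ts = xs @ a # b # ys" by blast
  have eq: "(1 + next_count ts 0) # words ts 0 [] = xs @ a # b # ys"
    using ts(3) by (simp add: root_word_def)
  have "length xs < sum_list (map edges ts)"
    using arg_cong[OF eq, of length] by (simp add: length_words)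
  moreover have "\<forall>t\<in>set ts. periodic t" using ts(2) by simp
  ultimately obtain ts' where "length ts' = length ts" "\<forall>t\<in>set ts'. periodic t"
      "(1 + next_count ts' 0) # words ts' 0 [] =
        xs @ Suc a # replicate (3 * k + 1) 1 @ Suc b # ys"
    using graft_ear[OF _ eq, of k] by blast
  thus ?case using ts(1,2) by (intro exI[of _ ts']) (auto simp: root_word_def)
qed

section \<open>Canonical trees\<close>

text \<open>The recursion by triples is also the decomposition used for counting: of
  \<open>3 * k + 2\<close> entries, \<open>k\<close> are forced to be trivial.\<close>

fun spaced :: "tree list \<Rightarrow> bool" where
  "spaced [a, b] \<longleftrightarrow> True"
| "spaced (a # b # c # ts) \<longleftrightarrow> c = Node [] \<and> spaced ts"
| "spaced _ \<longleftrightarrow> False"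

text \<open>The root cell is exempt: later only its children are asked to be canonical.\<close>

fun canonical :: "tree \<Rightarrow> bool" where
  "canonical (Node ts) \<longleftrightarrow> (ts = [] \<or> spaced ts) \<and> (\<forall>t\<in>set ts. canonical t)"

lemma spaced_length: "spaced ts \<Longrightarrow> length ts mod 3 = 2"
  by (induction ts rule: spaced.induct) auto

lemma canonical_periodic: "canonical t \<Longrightarrow> periodic t"
  by (induction t) (auto simp: spaced_length)

text \<open>
  The quiddity of a canonical tree can be parsed from left to right. When the current cell has
  reached a position where it may be closed, its next side would be one of the sides that have to
  be trivial; so it is closed if and only if the current vertex lies on cells that are still
  unaccounted for.
\<close>

lemma words_unique:
  assumes "\<And>t t' x x' u u'. \<lbrakk>t \<in> set ts; canonical t'; left_count t = left_count t'; x \<ge> 1; x' \<ge> 1;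
      word t x u = word t' x' u'\<rbrakk> \<Longrightarrow> t = t' \<and> x = x' \<and> u = u'"
    and "spaced ts" "spaced ts'" "\<forall>t\<in>set ts'. canonical t" "x \<ge> 1" "x' \<ge> 1"
    and "next_count ts x = next_count ts' x'" "words ts x u = words ts' x' u'"
  shows "ts = ts' \<and> x = x' \<and> u = u'"
  using assms
proof (induction ts arbitrary: ts' rule: spaced.induct)
  case (1 a b)
  obtain a' b' r' where ts': "ts' = a' # b' # r'" using 1(3) by (cases ts' rule: spaced.cases) auto
  have A: "a = a' \<and> Suc (left_count b) = Suc (left_count b') \<and>
      word b (Suc x) u = word b' (Suc (next_count r' x')) (words r' x' u')"
    by (rule 1(1)) (use 1(2-) ts' in simp_all)
  have B: "b = b' \<and> Suc x = Suc (next_count r' x') \<and> u = words r' x' u'"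
    by (rule 1(1)) (use 1(2-) ts' A in simp_all)
  \<comment> \<open>A third side would be trivial and contribute 0, but by \<open>B\<close> the
    contribution is \<open>x\<close>, which is positive.\<close>
  have "r' = []" using 1(3,5) ts' B by (cases r') auto
  thus ?case using A B ts' by simp
next
  case (2 a b c ts)
  have c: "c = Node []" "spaced ts" using 2(3) by auto
  obtain a' b' r' where ts': "ts' = a' # b' # r'" using 2(4) by (cases ts' rule: spaced.cases) auto
  have A: "a = a' \<and> Suc (left_count b) = Suc (left_count b') \<and>
      word b (Suc 0) (words (c # ts) x u) = word b' (Suc (next_count r' x')) (words r' x' u')"
    by (rule 2(2)) (use 2(3-) ts' c in simp_all)
  have B: "b = b' \<and> Suc 0 = Suc (next_count r' x') \<and> words (c # ts) x u = words r' x' u'"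
    by (rule 2(2)) (use 2(3-) ts' A c in simp_all)
  \<comment> \<open>Conversely, the contribution is 0 here, and \<open>x'\<close> is positive, so
    the other parse cannot close its cell either.\<close>
  obtain c' r where r': "r' = c' # r" using B 2(7) by (cases r') auto
  have c': "c' = Node []" "spaced r" using 2(4) ts' r' by auto
  have rest: "next_count ts x = next_count r x' \<and> words ts x u = words r x' u'"
    using B by (simp add: c c' r')
  have "ts = r \<and> x = x' \<and> u = u'"
  proof (rule 2(1))
    show "t = t' \<and> x = x' \<and> u = u'"
      if "t \<in> set ts" "canonical t'" "left_count t = left_count t'" "x \<ge> 1" "x' \<ge> 1"
        "word t x u = word t' x' u'" for t t' x x' u u'
      by (rule 2(2)) (use that in simp_all)
  qed (use 2(5-7) c c' ts' r' rest in simp_all)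
  thus ?case using conjunct1[OF A] conjunct1[OF B] ts' r' c(1) c'(1) by simp
qed (simp_all only: spaced.simps)

text \<open>Positivity of \<open>x\<close> and \<open>x'\<close> reflects the enclosing cell, which
  also has the rightmost vertex. The free tails \<open>u\<close> and \<open>u'\<close> let the parse
  find where the word of the tree ends.\<close>

lemma word_unique:
  assumes "canonical t" "canonical t'" "left_count t = left_count t'" "x \<ge> 1" "x' \<ge> 1"
    "word t x u = word t' x' u'"
  shows "t = t' \<and> x = x' \<and> u = u'"
  using assms
proof (induction t arbitrary: t' x x' u u')
  case (Node ts)
  obtain ts' where t': "t' = Node ts'" by (cases t')
  show ?case
  proof (cases "ts = []")
    case True
    hence "ts' = []" using Node.prems t' by (cases ts') auto
    thus ?thesis using True Node.prems t' by simp
  next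
    case False
    hence ne: "ts' \<noteq> []" using Node.prems t' by (cases ts; cases ts') auto
    have "ts = ts' \<and> x = x' \<and> u = u'"
    proof (rule words_unique)
      show "next_count ts x = next_count ts' x'"
        using Node.prems(3) False ne t' by (simp add: left_count_Node[of ts x] left_count_Node[of ts' x'])
      show "words ts x u = words ts' x' u'" using Node.prems(6) False ne t' by (simp add: word_Node)
      show "t = t' \<and> x = x' \<and> u = u'"
        if "t \<in> set ts" "canonical t'" "left_count t = left_count t'" "x \<ge> 1" "x' \<ge> 1"
          "word t x u = word t' x' u'" for t t' x x' u u'
        using Node.IH[OF that(1) _ that(2-6)] Node.prems(1) that(1) by simp
    qed (use Node.prems False ne t' in auto)
    thus ?thesis using t' by simp
  qed
qed

text \<open>The end of the root cell is recognised by the word being exhausted, so its row need not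
  be spaced. Peeling off the first child leaves the root word of the others.\<close>

lemma root_word_unique:
  assumes "\<forall>t\<in>set ts. canonical t" "\<forall>t\<in>set ts'. canonical t" "root_word ts = root_word ts'"
  shows "ts = ts'"
  using assms
proof (induction ts arbitrary: ts')
  case Nil
  have "length (words ts' 0 []) = 0" using Nil by (simp add: root_word_def)
  hence "length ts' = 0" using sum_edges_ge_length[of ts'] unfolding length_words by linarith
  thus ?case by simp
next
  case (Cons t ts)
  have "length (words ts' 0 []) = length (words (t # ts) 0 [])"
    using Cons.prems(3) by (simp only: root_word_def list.inject)
  hence "length (words ts' 0 []) \<noteq> 0" using edges_pos[of t] unfolding length_words by simp
  then obtain t' r where ts': "ts' = t' # r" by (cases ts') auto
  have "left_count t = left_count t'"
    "word t (Suc (next_count ts 0)) (words ts 0 []) = word t' (Suc (next_count r 0)) (words r 0 [])"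
    using Cons.prems(3) ts' by (simp_all add: root_word_def)
  hence eq: "t = t' \<and> Suc (next_count ts 0) = Suc (next_count r 0) \<and> words ts 0 [] = words r 0 []"
    using Cons.prems(1,2) ts' by (intro word_unique) simp_all
  hence "root_word ts = root_word r" by (simp add: root_word_def)
  thus ?case using Cons.IH[of r] Cons.prems(1,2) ts' eq by simp
qed

section \<open>Reduction to canonical form by surgeries\<close>

text \<open>Such rows may replace one another among the children of any cell, even when their
  lengths differ.\<close>

definition same_words :: "tree list \<Rightarrow> tree list \<Rightarrow> bool" where
  "same_words ts ts' \<longleftrightarrow>
     (\<forall>x u. words ts x u = words ts' x u \<and> next_count ts x = next_count ts' x)"

lemma same_words_refl: "same_words ts ts"
  by (simp add: same_words_def)

lemma same_words_trans: "same_words a b \<Longrightarrow> same_words b c \<Longrightarrow> same_words a c"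
  by (simp add: same_words_def)

lemma same_words_append: "same_words a b \<Longrightarrow> same_words c d \<Longrightarrow> same_words (a @ c) (b @ d)"
  by (simp add: same_words_def words_append next_count_append)

lemma same_words_Node:
  "same_words a b \<Longrightarrow> a \<noteq> [] \<Longrightarrow> b \<noteq> [] \<Longrightarrow> same_words [Node a] [Node b]"
  by (simp add: same_words_def word_Node left_count_Node[of _ 0])

text \<open>The row \<open>bs\<close> moves up to the enclosing cell, and the outer cell is split
  into \<open>Node p\<close> and \<open>Node rest\<close>. A vertex that loses the cell of
  \<open>bs\<close> gains the enclosing cell; one that loses the outer cell gains
  \<open>Node p\<close> or \<open>Node rest\<close>.\<close>

lemma same_words_surgery:
  assumes "p \<noteq> []" "bs \<noteq> []" "rest \<noteq> []"
  shows "same_words [Node (p @ Node bs # rest)] (Node p # bs @ [Node rest])"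
proof -
  have "next_count bs (Suc x) = next_count bs 0" "next_count rest (Suc x) = next_count rest 0"
    "next_count p (Suc x) = next_count p 0" for x
    using assms by (cases bs; cases rest; cases p; simp)+
  thus ?thesis using assms
    by (simp add: same_words_def word_Node left_count_Node[of _ 0] words_append next_count_append)
qed

text \<open>Take the first of the entries 3, 6, 9, ... that is not trivial: what precedes it is
  spaced and what follows again has length 2 mod 3, so both can form cells.\<close>

lemma spaced_or_split:
  assumes "length ds mod 3 = 2"
  shows "spaced ds \<or>
    (\<exists>p bs rest. ds = p @ Node bs # rest \<and> spaced p \<and> bs \<noteq> [] \<and> length rest mod 3 = 2)"
  using assms
proof (induction ds rule: spaced.induct)
  case (2 a b c ts)
  obtain bs where c: "c = Node bs" by (cases c)
  have len: "length ts mod 3 = 2" using 2(2) by (simp add: mod_Suc split: if_splits)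
  show ?case
  proof (cases "bs = []")
    case False
    have "a # b # c # ts = [a, b] @ Node bs # ts \<and> spaced [a, b]" by (simp add: c)
    thus ?thesis using False len by blast
  next
    case True
    from 2(1)[OF len] show ?thesis
    proof
      assume "spaced ts" thus ?thesis by (simp add: True c)
    next
      assume "\<exists>p bs rest. ts = p @ Node bs # rest \<and> spaced p \<and> bs \<noteq> [] \<and> length rest mod 3 = 2"
      then obtain p bs' rest where "ts = p @ Node bs' # rest" "spaced p" "bs' \<noteq> []"
        "length rest mod 3 = 2" by blast
      hence "a # b # c # ts = (a # b # c # p) @ Node bs' # rest \<and> spaced (a # b # c # p)"
        by (simp add: True c)
      thus ?thesis using \<open>bs' \<noteq> []\<close> \<open>length rest mod 3 = 2\<close> by blast
    qed
  qed
qed auto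

text \<open>After surgery at the first offending side, \<open>Node p\<close> and the trees in
  \<open>bs\<close> are canonical, and \<open>rest\<close> is shorter, so recursion applies. The
  resulting row has length 1 mod 3 and hence can stand for a single child.\<close>

lemma canonical_cell:
  assumes "\<forall>t\<in>set ds. canonical t" "length ds mod 3 = 2"
  shows "\<exists>cs. same_words [Node ds] cs \<and> (\<forall>t\<in>set cs. canonical t) \<and> length cs mod 3 = 1"
  using assms
proof (induction "length ds" arbitrary: ds rule: less_induct)
  case less
  consider "spaced ds" | p bs rest where "ds = p @ Node bs # rest" "spaced p" "bs \<noteq> []"
    "length rest mod 3 = 2"
    using spaced_or_split[OF less.prems(2)] by blast
  thus ?case
  proof cases
    case 1
    thus ?thesis using less.prems by (intro exI[of _ "[Node ds]"]) (simp add: same_words_refl)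
  next
    case 2
    obtain cs where cs: "same_words [Node rest] cs" "\<forall>t\<in>set cs. canonical t" "length cs mod 3 = 1"
      using less.hyps[of rest] less.prems 2 by auto
    have ne: "p \<noteq> []" "rest \<noteq> []" using 2 by auto
    have bs: "spaced bs" "\<forall>t\<in>set bs. canonical t" using less.prems 2 by auto
    have "same_words (Node p # bs @ [Node rest]) (Node p # bs @ cs)"
      using same_words_append[OF same_words_refl[of "Node p # bs"] cs(1)] by simp
    hence "same_words [Node ds] (Node p # bs @ cs)"
      using same_words_trans same_words_surgery[OF ne(1) 2(3) ne(2)] 2(1) by blast
    moreover have "\<forall>t\<in>set (Node p # bs @ cs). canonical t" using cs bs 2 less.prems by auto
    moreover have "length (Node p # bs @ cs) mod 3 = 1"
    proof -
      have "length bs mod 3 = 2" using bs spaced_length by blast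
      thus ?thesis using cs(3) by simp presburger
    qed
    ultimately show ?thesis by blast
  qed
qed

lemma canonical_list:
  assumes "\<And>t. t \<in> set ts \<Longrightarrow>
    \<exists>cs. same_words [t] cs \<and> (\<forall>t\<in>set cs. canonical t) \<and> length cs mod 3 = 1"
  shows "\<exists>ds. same_words ts ds \<and> (\<forall>t\<in>set ds. canonical t) \<and> length ds mod 3 = length ts mod 3"
  using assms
proof (induction ts)
  case Nil
  show ?case by (intro exI[of _ "[]"]) (simp add: same_words_refl)
next
  case (Cons t ts)
  obtain cs where cs: "same_words [t] cs" "\<forall>t\<in>set cs. canonical t" "length cs mod 3 = 1"
    using Cons.prems[of t] by auto
  obtain ds where ds: "same_words ts ds" "\<forall>t\<in>set ds. canonical t" "length ds mod 3 = length ts mod 3"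
    using Cons by auto
  have "length (cs @ ds) mod 3 = length (t # ts) mod 3" 
    using mod_add_cong[of "length cs" 3 1 "length ds" "length ts"] cs(3) ds(3) by simp
  moreover have "same_words (t # ts) (cs @ ds)" using same_words_append[OF cs(1) ds(1)] by simp
  ultimately show ?case using cs(2) ds(2) by (intro exI[of _ "cs @ ds"]) auto
qed

text \<open>Children first: their new row has the same length mod 3, so it again forms a 3-periodic
  cell, which \<open>canonical_cell\<close> then treats.\<close>

lemma canonical_tree:
  "periodic t \<Longrightarrow> \<exists>cs. same_words [t] cs \<and> (\<forall>t\<in>set cs. canonical t) \<and> length cs mod 3 = 1"
proof (induction t)
  case (Node ts)
  show ?case
  proof (cases "ts = []")
    case True
    thus ?thesis by (intro exI[of _ "[Node []]"]) (simp add: same_words_refl)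
  next
    case False
    have len: "length ts mod 3 = 2" using False Node.prems by simp
    obtain ds where ds: "same_words ts ds" "\<forall>t\<in>set ds. canonical t" "length ds mod 3 = length ts mod 3"
      using canonical_list[of ts] Node by auto
    have "ds \<noteq> []" using ds len by auto
    hence "same_words [Node ts] [Node ds]" using ds False same_words_Node by blast
    thus ?thesis using canonical_cell[OF ds(2)] ds(3) len same_words_trans by metis
  qed
qed

section \<open>Counting ear words by canonical roots\<close>

definition canonical_roots :: "tree list set" where
  "canonical_roots = {ts. length ts mod 3 = 2 \<and> (\<forall>t\<in>set ts. canonical t)}"

text \<open>The root has no enclosing cell to which surgery could move a row. Its children are made
  canonical, and of its own row only the length mod 3 is kept.\<close>

lemma ear_words_eq_root_words: "ear_words = root_word ` canonical_roots"
proof (intro equalityI subsetI)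
  fix w assume "w \<in> ear_words"
  then obtain ts where ts: "ts \<noteq> []" "periodic (Node ts)" "root_word ts = w"
    using ear_word_is_root_word by blast
  obtain ds where ds: "same_words ts ds" "\<forall>t\<in>set ds. canonical t" "length ds mod 3 = length ts mod 3"
    using canonical_list[of ts] canonical_tree ts(2) by auto
  have "root_word ds = w" using ds(1) ts(3) by (simp add: root_word_def same_words_def)
  thus "w \<in> root_word ` canonical_roots" using ds ts by (auto simp: canonical_roots_def)
next
  fix w assume "w \<in> root_word ` canonical_roots"
  then obtain ts where ts: "length ts mod 3 = 2" "\<forall>t\<in>set ts. canonical t" "w = root_word ts"
    by (auto simp: canonical_roots_def)
  hence "periodic (Node ts)" "ts \<noteq> []" using canonical_periodic by auto
  thus "w \<in> ear_words" using ts root_word_in_ear_words by blast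
qed

lemma inj_root_word: "inj_on root_word canonical_roots"
  by (rule inj_onI, rule root_word_unique) (auto simp: canonical_roots_def)

lemma length_root_word: "length (root_word ts) = Suc (sum_list (map edges ts))"
  by (simp add: root_word_def length_words)

lemma card_ear_words:
  "card {w \<in> ear_words. length w = n + 2} =
   card {ts \<in> canonical_roots. sum_list (map edges ts) = n + 1}"
proof -
  have "{w \<in> ear_words. length w = n + 2} =
      root_word ` {ts \<in> canonical_roots. sum_list (map edges ts) = n + 1}"
    by (auto simp: ear_words_eq_root_words length_root_word)
  thus ?thesis using inj_on_subset[OF inj_root_word] by (simp add: card_image)
qed

section \<open>Generating functions\<close>

unbundle fps_syntax

definition gen_fun :: "'a set \<Rightarrow> ('a \<Rightarrow> nat) \<Rightarrow> rat fps" where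
  "gen_fun A w = Abs_fps (\<lambda>n. of_nat (card {a \<in> A. w a = n}))"

text \<open>As \<open>card\<close> is 0 on infinite sets, this is what makes \<open>gen_fun\<close>
  a true count.\<close>

definition graded :: "'a set \<Rightarrow> ('a \<Rightarrow> nat) \<Rightarrow> bool" where
  "graded A w \<longleftrightarrow> (\<forall>n. finite {a \<in> A. w a = n})"

lemma gen_fun_Un:
  assumes "graded A w" "graded B w" "A \<inter> B = {}"
  shows "gen_fun (A \<union> B) w = gen_fun A w + gen_fun B w"
proof (rule fps_ext)
  fix n
  have "{a \<in> A \<union> B. w a = n} = {a \<in> A. w a = n} \<union> {a \<in> B. w a = n}" by auto
  moreover have "{a \<in> A. w a = n} \<inter> {a \<in> B. w a = n} = {}" using assms(3) by auto
  ultimately show "gen_fun (A \<union> B) w $ n = (gen_fun A w + gen_fun B w) $ n"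
    using assms(1,2) by (simp add: gen_fun_def graded_def card_Un_disjoint)
qed

lemma gen_fun_image:
  assumes "inj_on f A" "\<And>a. a \<in> A \<Longrightarrow> w (f a) = v a"
  shows "gen_fun (f ` A) w = gen_fun A v"
proof (rule fps_ext)
  fix n
  have "{b \<in> f ` A. w b = n} = f ` {a \<in> A. v a = n}" using assms(2) by auto
  moreover have "inj_on f {a \<in> A. v a = n}" using assms(1) by (auto simp: inj_on_def)
  ultimately show "gen_fun (f ` A) w $ n = gen_fun A v $ n"
    by (simp add: gen_fun_def card_image)
qed

lemma gen_fun_Times:
  assumes "graded A v" "graded B w"
  shows "gen_fun (A \<times> B) (\<lambda>(a, b). v a + w b) = gen_fun A v * gen_fun B w"
proof (rule fps_ext)
  fix n
  have "{p \<in> A \<times> B. (case p of (a, b) \<Rightarrow> v a + w b) = n} =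
      (\<Union>i\<in>{0..n}. {a \<in> A. v a = i} \<times> {b \<in> B. w b = n - i})" by auto
  also have "card \<dots> = (\<Sum>i=0..n. card ({a \<in> A. v a = i} \<times> {b \<in> B. w b = n - i}))"
    using assms by (intro card_UN_disjoint) (auto simp: graded_def)
  finally show "gen_fun (A \<times> B) (\<lambda>(a, b). v a + w b) $ n = (gen_fun A v * gen_fun B w) $ n"
    by (simp add: gen_fun_def fps_mult_nth card_cartesian_product)
qed

lemma gen_fun_Suc: "gen_fun A (\<lambda>a. Suc (w a)) = fps_X * gen_fun A w"
  by (rule fps_ext) (auto simp: gen_fun_def gr0_conv_Suc)

lemma gen_fun_singleton: "gen_fun {a} w = fps_X ^ w a"
proof (rule fps_ext)
  fix n
  have "{x \<in> {a}. w x = n} = (if n = w a then {a} else {})" by auto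
  thus "gen_fun {a} w $ n = fps_X ^ w a $ n" by (simp add: gen_fun_def fps_X_power_nth)
qed

lemma graded_Times:
  assumes "graded A v" "graded B w"
  shows "graded (A \<times> B) (\<lambda>(a, b). v a + w b)"
  unfolding graded_def
proof
  fix n
  have "{p \<in> A \<times> B. (case p of (a, b) \<Rightarrow> v a + w b) = n} \<subseteq>
      (\<Union>i\<in>{0..n}. {a \<in> A. v a = i} \<times> {b \<in> B. w b = n - i})" by auto
  moreover have "finite \<dots>" using assms by (auto simp: graded_def)
  ultimately show "finite {p \<in> A \<times> B. (case p of (a, b) \<Rightarrow> v a + w b) = n}"
    using finite_subset by blast
qed

lemma graded_subset:
  assumes "graded B w" "A \<subseteq> B"
  shows "graded A w"
  unfolding graded_def
proof
  show "finite {a \<in> A. w a = n}" for n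
    by (rule finite_subset[of _ "{b \<in> B. w b = n}"]) (use assms in \<open>auto simp: graded_def\<close>)
qed

abbreviation sum_edges :: "tree list \<Rightarrow> nat" where
  "sum_edges ts \<equiv> sum_list (map edges ts)"

lemma edges_le_sum_edges: "t \<in> set ts \<Longrightarrow> edges t + length ts \<le> Suc (sum_edges ts)"
proof (induction ts)
  case (Cons a ts)
  thus ?case using edges_pos[of a] sum_edges_ge_length[of ts] by auto
qed simp

text \<open>A cell has at least two children with at least one edge each, so every child has fewer
  edges than the cell, and strong induction leaves finitely many rows of bounded length.\<close>

lemma graded_canonical: "graded {t. canonical t} edges"
proof -
  have "finite {t. canonical t \<and> edges t = n}" for n
  proof (induction n rule: less_induct)
    case (less n)
    let ?T = "\<Union>m<n. {t. canonical t \<and> edges t = m}"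
    have "{t. canonical t \<and> edges t = n} \<subseteq>
        insert (Node []) (Node ` {ts. set ts \<subseteq> ?T \<and> length ts \<le> n})"
    proof
      fix t assume t: "t \<in> {t. canonical t \<and> edges t = n}"
      obtain ts where ts: "t = Node ts" by (cases t)
      show "t \<in> insert (Node []) (Node ` {ts. set ts \<subseteq> ?T \<and> length ts \<le> n})"
      proof (cases "ts = []")
        case False
        have "length ts mod 3 = 2" using t ts False by (auto dest: spaced_length)
        hence len: "length ts \<ge> 2" by presburger
        have n: "sum_edges ts = n" using t ts False by (simp add: edges_Node)
        have "edges s < n" if "s \<in> set ts" for s using edges_le_sum_edges[OF that] len n by simp
        hence "set ts \<subseteq> ?T" using t ts by auto
        thus ?thesis using ts sum_edges_ge_length[of ts] n by auto
      qed (simp add: ts)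
    qed
    moreover have "finite \<dots>" using less by (intro finite.insertI finite_imageI finite_lists_length_le) auto
    ultimately show ?case by (rule finite_subset)
  qed
  thus ?thesis by (simp add: graded_def)
qed

lemma graded_canonical_lists: "graded {ts. \<forall>t\<in>set ts. canonical t} sum_edges"
  unfolding graded_def
proof
  fix n
  let ?T = "\<Union>m\<le>n. {t. canonical t \<and> edges t = m}"
  have "{ts \<in> {ts. \<forall>t\<in>set ts. canonical t}. sum_edges ts = n} \<subseteq> {ts. set ts \<subseteq> ?T \<and> length ts \<le> n}"
  proof clarify
    fix ts assume ts: "\<forall>t\<in>set ts. canonical t"
    have "edges t \<le> sum_edges ts" if "t \<in> set ts" for t
      using that by (simp add: member_le_sum_list)
    thus "set ts \<subseteq> (\<Union>m\<le>sum_edges ts. {t. canonical t \<and> edges t = m}) \<and> length ts \<le> sum_edges ts"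
      using ts sum_edges_ge_length[of ts] by auto
  qed
  moreover have "finite \<dots>"
    using graded_canonical by (intro finite_lists_length_le) (auto simp: graded_def)
  ultimately show "finite {ts \<in> {ts. \<forall>t\<in>set ts. canonical t}. sum_edges ts = n}"
    by (rule finite_subset)
qed

section \<open>Recursions for the counting series\<close>

text \<open>With \<open>P\<close> as in the theorem this series turns out to be
  \<open>fps_X * P\<close>; likewise \<open>cell_gf\<close> is \<open>fps_X * (P - 1)\<close> and
  \<open>root_gf\<close> is \<open>fps_X * (Q_fps - 1)\<close>.\<close>

definition canonical_gf :: "rat fps" where
  "canonical_gf = gen_fun {t. canonical t} edges"

definition canonical_cells :: "tree list set" where
  "canonical_cells = {ts. spaced ts \<and> (\<forall>t\<in>set ts. canonical t)}"

definition cell_gf :: "rat fps" where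
  "cell_gf = gen_fun canonical_cells sum_edges"

definition root_gf :: "rat fps" where
  "root_gf = gen_fun canonical_roots sum_edges"

lemma graded_canonical_cells: "graded canonical_cells sum_edges"
  by (rule graded_subset[OF graded_canonical_lists]) (auto simp: canonical_cells_def)

lemma graded_canonical_roots: "graded canonical_roots sum_edges"
  by (rule graded_subset[OF graded_canonical_lists]) (auto simp: canonical_roots_def)

lemma canonical_gf_eq: "canonical_gf = fps_X + cell_gf"
proof -
  have split: "{t. canonical t} = {Node []} \<union> Node ` canonical_cells"
  proof (intro equalityI subsetI)
    fix t assume "t \<in> {t. canonical t}"
    thus "t \<in> {Node []} \<union> Node ` canonical_cells" by (cases t) (auto simp: canonical_cells_def)
  qed (auto simp: canonical_cells_def)
  have "graded {Node []} edges" "graded (Node ` canonical_cells) edges"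
    by (rule graded_subset[OF graded_canonical], subst split, blast)+
  moreover have "{Node []} \<inter> Node ` canonical_cells = {}" by (auto simp: canonical_cells_def)
  ultimately have "canonical_gf = gen_fun {Node []} edges + gen_fun (Node ` canonical_cells) edges"
    unfolding canonical_gf_def split by (rule gen_fun_Un)
  moreover have "gen_fun (Node ` canonical_cells) edges = cell_gf"
    unfolding cell_gf_def
  proof (rule gen_fun_image)
    fix ts assume "ts \<in> canonical_cells"
    hence "ts \<noteq> []" by (auto simp: canonical_cells_def)
    thus "edges (Node ts) = sum_edges ts" by (rule edges_Node)
  qed (simp add: inj_on_def)
  ultimately show ?thesis by (simp add: gen_fun_singleton)
qed

lemma gen_fun_pairs:
  "gen_fun ((\<lambda>(a, b). [a, b]) ` ({t. canonical t} \<times> {t. canonical t})) sum_edges = canonical_gf ^ 2"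
proof -
  have "gen_fun ((\<lambda>(a, b). [a, b]) ` ({t. canonical t} \<times> {t. canonical t})) sum_edges =
      gen_fun ({t. canonical t} \<times> {t. canonical t}) (\<lambda>(a, b). edges a + edges b)"
    by (rule gen_fun_image) (auto simp: inj_on_def)
  also have "\<dots> = canonical_gf ^ 2"
    unfolding canonical_gf_def power2_eq_square
    by (intro gen_fun_Times graded_canonical)
  finally show ?thesis .
qed

text \<open>A spaced row is a pair of trees, possibly followed by a forced trivial side, of weight
  \<open>fps_X\<close>, and a spaced row.\<close>

lemma cell_gf_eq: "cell_gf = canonical_gf ^ 2 + fps_X * canonical_gf ^ 2 * cell_gf"
proof -
  let ?T = "{t. canonical t}" and ?S = canonical_cells
  let ?A = "(\<lambda>(a, b). [a, b]) ` (?T \<times> ?T)"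
  let ?B = "(\<lambda>(a, b, ts). a # b # Node [] # ts) ` (?T \<times> ?T \<times> ?S)"
  have split: "?S = ?A \<union> ?B"
  proof (intro equalityI subsetI)
    fix ts assume "ts \<in> ?S"
    thus "ts \<in> ?A \<union> ?B"
      by (cases ts rule: spaced.cases) (auto simp: canonical_cells_def image_iff)
  qed (auto simp: canonical_cells_def)
  have "graded ?A sum_edges" "graded ?B sum_edges"
    by (rule graded_subset[OF graded_canonical_cells], subst split, blast)+
  moreover have "?A \<inter> ?B = {}" by auto
  ultimately have "cell_gf = gen_fun ?A sum_edges + gen_fun ?B sum_edges"
    unfolding cell_gf_def by (subst split, rule gen_fun_Un)
  moreover have "gen_fun ?B sum_edges = gen_fun (?T \<times> ?T \<times> ?S)
      (\<lambda>p. Suc (case p of (a, q) \<Rightarrow> edges a + (case q of (b, ts) \<Rightarrow> edges b + sum_edges ts)))"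
    by (rule gen_fun_image) (auto simp: inj_on_def)
  moreover have "\<dots> = fps_X * (canonical_gf * (canonical_gf * cell_gf))"
    unfolding gen_fun_Suc canonical_gf_def cell_gf_def
    by (simp only: gen_fun_Times graded_Times graded_canonical graded_canonical_cells)
  ultimately show ?thesis
    unfolding gen_fun_pairs by (simp add: power2_eq_square mult.assoc)
qed

text \<open>The third side is free here, so a third factor \<open>canonical_gf\<close> takes the
  place of \<open>fps_X\<close>.\<close>

lemma root_gf_eq: "root_gf = canonical_gf ^ 2 + canonical_gf ^ 3 * root_gf"
proof -
  let ?T = "{t. canonical t}" and ?S = canonical_roots
  let ?A = "(\<lambda>(a, b). [a, b]) ` (?T \<times> ?T)"
  let ?B = "(\<lambda>(a, b, c, ts). a # b # c # ts) ` (?T \<times> ?T \<times> ?T \<times> ?S)"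
  have split: "?S = ?A \<union> ?B"
  proof (intro equalityI subsetI)
    fix ts assume ts: "ts \<in> ?S"
    hence len: "length ts mod 3 = 2" by (simp add: canonical_roots_def)
    show "ts \<in> ?A \<union> ?B"
    proof (cases ts rule: spaced.cases)
      case (2 a b c us)
      hence "length us mod 3 = 2" using len by (simp add: mod_Suc split: if_splits)
      thus ?thesis using ts 2 by (auto simp: canonical_roots_def image_iff)
    qed (use ts in \<open>auto simp: canonical_roots_def image_iff\<close>)
  qed (auto simp: canonical_roots_def)
  have "graded ?A sum_edges" "graded ?B sum_edges"
    by (rule graded_subset[OF graded_canonical_roots], subst split, blast)+
  moreover have "?A \<inter> ?B = {}" by (auto simp: canonical_roots_def)
  ultimately have "root_gf = gen_fun ?A sum_edges + gen_fun ?B sum_edges"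
    unfolding root_gf_def by (subst split, rule gen_fun_Un)
  moreover have "gen_fun ?B sum_edges = gen_fun (?T \<times> ?T \<times> ?T \<times> ?S)
      (\<lambda>(a, q). edges a + (case q of (b, r) \<Rightarrow> edges b +
        (case r of (c, ts) \<Rightarrow> edges c + sum_edges ts)))"
    by (rule gen_fun_image) (auto simp: inj_on_def)
  moreover have "\<dots> = canonical_gf * (canonical_gf * (canonical_gf * root_gf))"
    unfolding canonical_gf_def root_gf_def
    by (simp only: gen_fun_Times graded_Times graded_canonical graded_canonical_roots)
  ultimately show ?thesis
    unfolding gen_fun_pairs by (simp add: power3_eq_cube mult.assoc)
qed

lemma Q_eq_card_canonical_roots:
  "n \<ge> 1 \<Longrightarrow> Q n = card {ts \<in> canonical_roots. sum_edges ts = n + 1}"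
  by (simp only: Q_def quiddities_eq_ear_words card_ear_words) simp

text \<open>An \<open>(n+2)\<close>-gon has \<open>n + 1\<close> sides besides the base, whence the
  shift. A root has at least two children, so the coefficients 0 and 1 vanish, in accordance with
  \<open>Q 0 = 1\<close>.\<close>

lemma root_gf_Q: "root_gf = fps_X * (Q_fps - 1)"
proof (rule fps_ext)
  fix n
  have small: "{ts \<in> canonical_roots. sum_edges ts = n} = {}" if "n \<le> 1"
  proof -
    have "\<not> sum_edges ts \<le> 1" if "ts \<in> canonical_roots" for ts
    proof -
      have "length ts mod 3 = 2" using that by (simp add: canonical_roots_def)
      hence "length ts \<ge> 2" by presburger
      thus ?thesis using sum_edges_ge_length[of ts] by simp
    qed
    thus ?thesis using that by auto
  qed
  show "root_gf $ n = (fps_X * (Q_fps - 1)) $ n"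
  proof (cases "n \<le> 1")
    case True
    hence "root_gf $ n = 0" by (simp only: root_gf_def gen_fun_def small fps_nth_Abs_fps card.empty of_nat_0)
    thus ?thesis using True by (cases n) (auto simp: Q_fps_def Q_def)
  next
    case False
    then obtain m where "n = Suc m" "m \<ge> 1" by (cases n) auto
    thus ?thesis using Q_eq_card_canonical_roots[of m] by (simp add: root_gf_def gen_fun_def Q_fps_def)
  qed
qed

section \<open>The functional equations\<close>

lemma fps_eq_divide_iff:
  fixes a b c :: "rat fps"
  assumes "c $ 0 \<noteq> 0"
  shows "a = b / c \<longleftrightarrow> a * c = b"
proof -
  have "c \<noteq> 0" using assms by auto
  moreover have "b / c * c = b"
    using assms by (simp add: fps_divide_unit mult.assoc inverse_mult_eq_1)
  ultimately show ?thesis by (metis fps_divide_times_eq)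
qed

text \<open>The partial sums are \<open>b - b * r ^ n\<close>, and \<open>r ^ n\<close> has no terms
  below degree \<open>n\<close>, so every coefficient is eventually constant.\<close>

lemma fps_geometric_sums:
  fixes a b :: "rat fps"
  assumes b: "b * (1 - r) = a" and r: "r $ 0 = 0"
  shows "(\<lambda>k. a * r ^ k) sums b"
proof -
  have part: "(\<Sum>k<n. a * r ^ k) = b - b * r ^ n" for n
    by (induction n) (simp_all add: b[symmetric] algebra_simps)
  show ?thesis unfolding sums_def
  proof (rule tendsto_fpsI)
    fix m
    have "(\<Sum>k<n. a * r ^ k) $ m = b $ m" if "n > m" for n
    proof -
      have "(b * r ^ n) $ m = 0"
      proof -
        have "(r ^ n) $ i = 0" if "i \<le> m" for i
          using startsby_zero_power_prefix[OF r] that \<open>n > m\<close> by auto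
        thus ?thesis by (simp add: fps_mult_nth)
      qed
      thus ?thesis by (simp add: part)
    qed
    thus "\<forall>\<^sub>F n in sequentially. (\<Sum>k<n. a * r ^ k) $ m = b $ m"
      by (auto simp: eventually_sequentially intro!: exI[of _ "Suc m"])
  qed
qed

lemma functional_equation_iff:
  fixes P :: "rat fps"
  shows "P = 1 + fps_X * P^2 / (1 - fps_X^3 * P^2) \<longleftrightarrow>
    (P - 1) * (1 - fps_X^3 * P^2) = fps_X * P^2"
proof -
  have "(1 - fps_X^3 * P^2) $ 0 \<noteq> 0" by (simp add: fps_mult_nth_0)
  from fps_eq_divide_iff[OF this, of "P - 1" "fps_X * P^2"] show ?thesis
    by (metis add_diff_cancel_left' diff_add_cancel add.commute)
qed

lemma functional_equation_unique:
  fixes P R :: "rat fps"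
  assumes "(P - 1) * (1 - fps_X^3 * P^2) = fps_X * P^2" "(R - 1) * (1 - fps_X^3 * R^2) = fps_X * R^2"
  shows "P = R"
proof -
  \<comment> \<open>The difference of the two equations divided by \<open>P - R\<close>; its
    constant term is 1, so it is nonzero and forces \<open>P - R = 0\<close>.\<close>
  let ?c = "1 - fps_X^3 * (P^2 + P * R + R^2) + fps_X^3 * (P + R) - fps_X * (P + R)"
  have "(P - R) * ?c =
      ((P - 1) * (1 - fps_X^3 * P^2) - fps_X * P^2) - ((R - 1) * (1 - fps_X^3 * R^2) - fps_X * R^2)"
    by (simp add: algebra_simps power2_eq_square power3_eq_cube)
  hence "(P - R) * ?c = 0" using assms by simp
  moreover have "?c $ 0 = 1" by (simp add: fps_mult_nth_0)
  hence "?c \<noteq> 0" by (metis fps_zero_nth zero_neq_one)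
  ultimately show ?thesis by (metis mult_eq_0_iff right_minus_eq)
qed

text \<open>The solution comes from counting: every tree has an edge, so \<open>canonical_gf\<close>
  is divisible by \<open>fps_X\<close>. The equations for \<open>canonical_gf\<close> and
  \<open>cell_gf\<close> then combine, after cancelling \<open>fps_X\<close>, to the one for the
  quotient \<open>P\<close>.\<close>

lemma functional_equation_exists:
  "\<exists>P :: rat fps. canonical_gf = fps_X * P \<and> (P - 1) * (1 - fps_X^3 * P^2) = fps_X * P^2"
proof -
  have "{t. canonical t \<and> edges t = 0} = {}" using edges_pos by (force simp: Suc_le_eq)
  hence "canonical_gf $ 0 = 0"
    by (simp only: canonical_gf_def gen_fun_def fps_nth_Abs_fps mem_Collect_eq card.empty of_nat_0)
  hence E: "canonical_gf = fps_X * fps_shift 1 canonical_gf"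
    by (intro fps_ext) (auto simp: gr0_conv_Suc)
  define P where "P = fps_shift 1 canonical_gf"
  have EP: "canonical_gf = fps_X * P" using E by (simp add: P_def)
  have S: "cell_gf = fps_X * (P - 1)" using canonical_gf_eq EP by (simp add: algebra_simps)
  have "fps_X * ((P - 1) * (1 - fps_X^3 * P^2)) = fps_X * (fps_X * P^2)"
    using cell_gf_eq unfolding S EP by (simp add: algebra_simps power2_eq_square power3_eq_cube)
  hence "(P - 1) * (1 - fps_X^3 * P^2) = fps_X * P^2" by (simp only: mult_cancel_left fps_X_neq_zero simp_thms)
  thus ?thesis using EP by blast
qed

theorem theorem2p3:
  "(\<exists>!P :: rat fps. P = 1 + fps_X * P^2 / (1 - fps_X^3 * P^2)) \<and>
   (\<forall>P :: rat fps. P = 1 + fps_X * P^2 / (1 - fps_X^3 * P^2) \<longrightarrow>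
      (\<lambda>k. fps_X^(3*k+1) * P^(2*k+2)) sums (P - 1) \<and>
      Q_fps = 1 + fps_X * P^2 / (1 - fps_X^3 * P^3) \<and>
      (\<lambda>k. fps_X^(3*k+1) * P^(3*k+2)) sums (Q_fps - 1))"
  unfolding functional_equation_iff
proof (intro conjI allI impI)
  show "\<exists>!P :: rat fps. (P - 1) * (1 - fps_X^3 * P^2) = fps_X * P^2"
    using functional_equation_exists functional_equation_unique by blast
next
  fix P :: "rat fps"
  assume P: "(P - 1) * (1 - fps_X^3 * P^2) = fps_X * P^2"
  have "(\<lambda>k. fps_X * P^2 * (fps_X^3 * P^2)^k) sums (P - 1)"
    by (rule fps_geometric_sums[OF P]) (simp add: fps_mult_nth_0)
  moreover have "fps_X * P^2 * (fps_X^3 * P^2)^k = fps_X^(3*k+1) * P^(2*k+2)" for k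
    by (simp only: power_mult_distrib power_add power_mult[symmetric] power_one_right mult_ac)
  ultimately show "(\<lambda>k. fps_X^(3*k+1) * P^(2*k+2)) sums (P - 1)" by simp
  \<comment> \<open>By uniqueness, the given \<open>P\<close> is the series obtained from canonical
    trees.\<close>
  have EP: "canonical_gf = fps_X * P"
    using functional_equation_exists functional_equation_unique[OF P] by blast
  have "fps_X * ((Q_fps - 1) * (1 - fps_X^3 * P^3)) = fps_X * (fps_X * P^2)"
    using root_gf_eq unfolding root_gf_Q EP
    by (simp add: algebra_simps power2_eq_square power3_eq_cube)
  hence Q: "(Q_fps - 1) * (1 - fps_X^3 * P^3) = fps_X * P^2"
    by (simp only: mult_cancel_left fps_X_neq_zero simp_thms)
  have "(1 - fps_X^3 * P^3) $ 0 \<noteq> 0" by (simp add: fps_mult_nth_0)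
  from fps_eq_divide_iff[OF this, of "Q_fps - 1" "fps_X * P^2"] Q
  show "Q_fps = 1 + fps_X * P^2 / (1 - fps_X^3 * P^3)"
    by (metis add_diff_cancel_left' diff_add_cancel add.commute)
  have "(\<lambda>k. fps_X * P^2 * (fps_X^3 * P^3)^k) sums (Q_fps - 1)"
    by (rule fps_geometric_sums[OF Q]) (simp add: fps_mult_nth_0)
  moreover have "fps_X * P^2 * (fps_X^3 * P^3)^k = fps_X^(3*k+1) * P^(3*k+2)" for k
    by (simp only: power_mult_distrib power_add power_mult[symmetric] power_one_right mult_ac)
  ultimately show "(\<lambda>k. fps_X^(3*k+1) * P^(3*k+2)) sums (Q_fps - 1)" by simp
qed

end
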